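(* Let $A\in\mathbb{C}^{n\times n}$ ($n\ge 1$) be factorized as $A=Q\,\mathrm{diag}(J_1,\ldots,J_p)\,Q^{-1}$, where $Q\in\mathbb{C}^{n\times n}$ is nonsingular and each $J_i\in\mathbb{C}^{m_i\times m_i}$ ($\sum_{i=1}^p m_i=n$) is a Jordan block. Let $\widetilde{A}=A+E$ with $E\in\mathbb{C}^{n\times n}$ arbitrary. Let $\{\lambda_i\}_{i=1}^n$ and $\{\widetilde{\lambda}_i\}_{i=1}^n$ be the spectra of $A$ and $\widetilde{A}$, respectively. Put $m=\max_{1\le i\le p}m_i$ and $E_Q=Q^{-1}EQ$. Then there exists a permutation $\pi$ of $\{1,\ldots,n\}$ such that $$\Big(\sum_{i=1}^n|\widetilde{\lambda}_{\pi(i)}-\lambda_i|^2\Big)^{1/2}\le\begin{cases}\sqrt{mn\Big(\frac{n-p+2\sqrt{n-p}\,\delta(E_Q)}{m-1}\Big)^{1-\frac1m}\delta(E_Q)^{2/m}+\frac1n|\mathrm{tr}(E)|^2}, & \text{if } n-p+2\sqrt{n-p}\,\delta(E_Q)>(m-1)\delta(E_Q)^2,\\[2mm] \sqrt{n\big(\sqrt{n-p}+\delta(E_Q)\big)^2+\frac1n|\mathrm{tr}(E)|^2}, & \text{if } n-p+2\sqrt{n-p}\,\delta(E_Q)\le(m-1)\delta(E_Q)^2.\end{cases}$$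
   Context: $\|\cdot\|_F$ is the Frobenius norm and $\mathrm{tr}$ the trace. For $Y\in\mathbb{C}^{n\times n}$, $\delta(Y):=\big(\|Y\|_F^2-\frac1n|\mathrm{tr}(Y)|^2\big)^{1/2}$. Spectra are listed with algebraic multiplicity (so each has exactly $n$ entries). A Jordan block of size $m_i$ is an upper bidiagonal $m_i\times m_i$ matrix with a constant complex number on the diagonal, ones on the first superdiagonal, and zeros elsewhere; blocks may share the same eigenvalue. (If $m=1$ then $n=p$ and the second case applies, so the division by $m-1$ occurs only when $m>1$.) *)

theory Defs
  imports Jordan_Normal_Form.Jordan_Normal_Form
begin

definition mat_trace :: "complex mat \<Rightarrow> complex" where
  "mat_trace Y = (\<Sum>i<dim_row Y. Y $$ (i, i))"

definition frob_norm :: "complex mat \<Rightarrow> real" where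
  "frob_norm Y = sqrt (\<Sum>i<dim_row Y. \<Sum>j<dim_col Y. (cmod (Y $$ (i, j)))\<^sup>2)"

(* Used for square Y only, so dim_row Y is the order n of Y.  The radicand is nonnegative by
   the Cauchy-Schwarz inequality. *)
definition mat_delta :: "complex mat \<Rightarrow> real" where
  "mat_delta Y = sqrt ((frob_norm Y)\<^sup>2 - (cmod (mat_trace Y))\<^sup>2 / real (dim_row Y))"

(* l 1, ..., l n enumerates the spectrum of Y (n being the order of Y): every complex number z
   occurs among these values exactly as often as its algebraic multiplicity, i.e. its order as
   a root of the characteristic polynomial (0 if z is not an eigenvalue). *)
definition lists_spectrum :: "complex mat \<Rightarrow> (nat \<Rightarrow> complex) \<Rightarrow> bool" where
  "lists_spectrum Y l \<longleftrightarrow>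
     (\<forall>z. card {i \<in> {1..dim_row Y}. l i = z} = Polynomial.order z (char_poly Y))"

end

theory Submission
  imports Defs "HOL-Combinatorics.Permutations" "HOL-Analysis.Convex" Jordan_Normal_Form.Schur_Decomposition
begin

text \<open>
Let \<open>J\<close> be the Jordan matrix and let \<open>D\<close> be diagonal with the powers \<open>s ^ 0, s ^ 1, \<dots>\<close> along each
Jordan block, where \<open>0 < s \<le> 1\<close>. Conjugation by \<open>Q\<close> and \<open>D\<close> makes \<open>A + E\<close> similar to \<open>\<Lambda> + F\<close>, where
\<open>\<Lambda>\<close> is the diagonal of \<open>J\<close> and \<open>F\<close> is \<open>s\<close> times the nilpotent part of \<open>J\<close> plus \<open>D\<close>-scaled \<open>EQ\<close>. A
small \<open>s\<close> suppresses the nilpotent part and inflates the perturbation by up to \<open>s ^ (1 - m)\<close>. With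
\<open>a = n - p + 2 * sqrt (n - p) * \<delta>\<close> the result is \<open>(mat_delta F)\<^sup>2 \<le> s\<^sup>2 * a + \<delta>\<^sup>2 / (s\<^sup>2) ^ (m - 1)\<close>
(lemma \<open>graded_scaling_bound\<close>).

As \<open>\<Lambda>\<close> is normal, its spectrum can be matched with that of the arbitrary matrix \<open>\<Lambda> + F\<close> at squared
cost at most \<open>n * (mat_delta F)\<^sup>2 + |tr F|\<^sup>2 / n\<close> (lemma \<open>spectral_variation_diag\<close>). This is Sun's
generalisation of the Hoffman--Wielandt theorem with the trace split off. It rests on a unitary Schur
form \<open>T\<close> of \<open>\<Lambda> + F\<close>: in the same basis \<open>\<Lambda>\<close> becomes a normal matrix \<open>X\<close>; the part of \<open>X\<close> above the
diagonal is bounded by the part below, where \<open>T\<close> vanishes (lemma \<open>balanced_upper_le_lower\<close>); and the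
distance from \<open>X\<close> to the diagonal of \<open>T\<close> is an average, over a doubly stochastic matrix, of matching
costs, so some permutation does at least as well (lemma \<open>doubly_stochastic_assignment\<close>).

Finally \<open>s\<close> is optimised. If \<open>a > (m - 1) * \<delta>\<^sup>2\<close>, the optimum lies below 1 and yields the first case
of the bound; otherwise \<open>s = 1\<close> yields the second one, since \<open>a + \<delta>\<^sup>2 = (sqrt (n - p) + \<delta>)\<^sup>2\<close>. The
matching produced above depends on \<open>s\<close>, whereas for \<open>\<delta> = 0\<close> a limit \<open>s \<rightarrow> 0\<close> is taken; a permutation
of least cost among all of them satisfies the bounds for every \<open>s\<close> at the same time.
\<close>

section \<open>Optimal assignments and doubly stochastic matrices\<close>

text \<open>
A circulation on a finite vertex set is a nonnegative combination of cycles, and each cycle is the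
support of a permutation. So follow edges of positive weight until they close up, subtract as much
flow as possible along the cycle found, and induct on the number of edges carrying flow.
\<close>

lemma circulation_cost_nonneg:
  fixes S d :: "'a \<Rightarrow> 'a \<Rightarrow> real"
  assumes fin: "finite V"
    and S0: "\<And>i j. i \<in> V \<Longrightarrow> j \<in> V \<Longrightarrow> S i j \<ge> 0"
    and bal: "\<And>i. i \<in> V \<Longrightarrow> (\<Sum>j\<in>V. S i j) = (\<Sum>j\<in>V. S j i)"
    and d0: "\<And>i. i \<in> V \<Longrightarrow> d i i = 0"
    and d: "\<And>\<sigma>. \<sigma> permutes V \<Longrightarrow> (\<Sum>i\<in>V. d i (\<sigma> i)) \<ge> 0"
  shows "(\<Sum>i\<in>V. \<Sum>j\<in>V. S i j * d i j) \<ge> 0"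
  using S0 bal
proof (induction "card {(i, j). i \<in> V \<and> j \<in> V \<and> i \<noteq> j \<and> S i j > 0}" arbitrary: S rule: less_induct)
  case less
  note S0 = less.prems(1) and bal = less.prems(2)
  define W where "W = {i \<in> V. \<exists>j\<in>V. j \<noteq> i \<and> S i j > 0}"
  have finW: "finite W" using fin by (simp add: W_def)
  show ?case
  proof (cases "W = {}")
    case True
    have "S i j * d i j = 0" if "i \<in> V" "j \<in> V" for i j
      using True that S0[OF that] d0[of i] by (cases "i = j") (auto simp: W_def order_less_le)
    then have "(\<Sum>i\<in>V. \<Sum>j\<in>V. S i j * d i j) = (\<Sum>i\<in>V. \<Sum>j\<in>V. 0)" by (intro sum.cong refl)
    then show ?thesis by simp
  next
    case False
    have succ: "\<exists>j. j \<in> W \<and> j \<noteq> i \<and> S i j > 0" if "i \<in> W" for i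
    proof -
      from that obtain j where j: "i \<in> V" "j \<in> V" "j \<noteq> i" "S i j > 0" by (auto simp: W_def)
      have "(\<Sum>k\<in>V - {j}. S j k) = (\<Sum>k\<in>V - {j}. S k j)"
        using bal[OF j(2)] sum.remove[OF fin j(2), of "\<lambda>k. S j k"] sum.remove[OF fin j(2), of "\<lambda>k. S k j"]
        by linarith
      moreover have "(\<Sum>k\<in>V - {j}. S k j) > 0"
        by (rule sum_pos2[of _ i]) (use j fin S0 in auto)
      ultimately have "(\<Sum>k\<in>V - {j}. S j k) \<noteq> 0" by simp
      then obtain k where "k \<in> V - {j}" "S j k \<noteq> 0" by (rule sum.not_neutral_contains_not_neutral)
      with S0[of j k] j have "j \<in> W" by (auto simp: W_def intro!: bexI[of _ k])
      with j show ?thesis by blast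
    qed
    then obtain f where f: "\<And>i. i \<in> W \<Longrightarrow> f i \<in> W \<and> f i \<noteq> i \<and> S i (f i) > 0" by metis
    \<comment> \<open>On a smallest nonempty set closed under \<open>f\<close> the map \<open>f\<close> is a bijection.\<close>
    define closed where "closed C \<longleftrightarrow> C \<subseteq> W \<and> C \<noteq> {} \<and> f ` C \<subseteq> C" for C
    have "closed W" using False f by (auto simp: closed_def)
    from ex_has_least_nat[of closed, OF this, of card] obtain C
      where "closed C" and least: "\<forall>C'. closed C' \<longrightarrow> card C \<le> card C'" by blast
    then have C: "C \<subseteq> W" "C \<noteq> {}" "f ` C \<subseteq> C" by (auto simp: closed_def)
    have finC: "finite C" using C finW finite_subset by blast
    have fC: "f ` C = C"
    proof (rule card_subset_eq[OF finC C(3)])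
      have "closed (f ` C)" using C by (auto simp: closed_def)
      then have "card C \<le> card (f ` C)" using least by blast
      then show "card (f ` C) = card C" using card_image_le[OF finC, of f] by simp
    qed
    have bij: "bij_betw f C C" using fC finC by (simp add: bij_betw_def eq_card_imp_inj_on)
    define \<sigma> where "\<sigma> i = (if i \<in> C then f i else i)" for i
    have CV: "C \<subseteq> V" using C by (auto simp: W_def)
    have "bij_betw \<sigma> C C" using bij by (subst bij_betw_cong[of _ _ f]) (auto simp: \<sigma>_def)
    then have permC: "\<sigma> permutes C" by (rule bij_imp_permutes) (simp add: \<sigma>_def)
    then have perm: "\<sigma> permutes V" using CV permutes_subset by blast
    \<comment> \<open>The largest amount that can be cancelled on all of \<open>C\<close> at once; it empties some edge.\<close>
    define t where "t = Min ((\<lambda>i. S i (f i)) ` C)"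
    have t: "t > 0" "\<And>i. i \<in> C \<Longrightarrow> t \<le> S i (f i)"
      using finC C f by (auto simp: t_def intro!: Min_le)
    have "t \<in> (\<lambda>i. S i (f i)) ` C" unfolding t_def using finC C by (intro Min_in) auto
    then obtain a where a: "a \<in> C" "S a (f a) = t" by auto
    define S' where "S' i j = S i j - (if i \<in> C \<and> j = f i then t else 0)" for i j
    have row: "(\<Sum>j\<in>V. S' i j * g j) = (\<Sum>j\<in>V. S i j * g j) - (if i \<in> C then t * g (f i) else 0)"
      if "i \<in> V" for i and g :: "'a \<Rightarrow> real"
    proof -
      have "f i \<in> V" if "i \<in> C" using that CV fC by blast
      then have "(\<Sum>j\<in>V. (if i \<in> C \<and> j = f i then t else 0) * g j) = (if i \<in> C then t * g (f i) else 0)"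
        using fin by (auto simp: sum.delta if_distrib[of "\<lambda>x. x * _"] cong: if_cong)
      then show ?thesis by (simp add: S'_def left_diff_distrib sum_subtractf)
    qed
    have col: "(\<Sum>i\<in>V. S' i j) = (\<Sum>i\<in>V. S i j) - (if j \<in> C then t else 0)" if "j \<in> V" for j
    proof -
      have "(\<Sum>i\<in>V. if i \<in> C \<and> j = f i then t else 0) = (\<Sum>i\<in>C. if j = f i then t else 0)"
        using CV fin by (intro sum.mono_neutral_cong_right) auto
      also have "\<dots> = (\<Sum>i\<in>C. if j = i then t else 0)"
        using sum.reindex_bij_betw[OF bij, of "\<lambda>i. if j = i then t else 0"] by simp
      also have "\<dots> = (if j \<in> C then t else 0)" using finC by simp
      finally show ?thesis by (simp add: S'_def sum_subtractf)
    qed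
    have "(\<Sum>i\<in>V. \<Sum>j\<in>V. S' i j * d i j) \<ge> 0"
    proof (rule less.hyps)
      show "S' i j \<ge> 0" if "i \<in> V" "j \<in> V" for i j using S0[OF that] t by (auto simp: S'_def)
      show "(\<Sum>j\<in>V. S' i j) = (\<Sum>j\<in>V. S' j i)" if "i \<in> V" for i
        using row[OF that, of "\<lambda>_. 1"] col[OF that] bal[OF that] by simp
      have "{(i, j). i \<in> V \<and> j \<in> V \<and> i \<noteq> j \<and> S' i j > 0} \<subseteq> {(i, j). i \<in> V \<and> j \<in> V \<and> i \<noteq> j \<and> S i j > 0}"
        using t by (auto simp: S'_def split: if_splits)
      moreover have "(a, f a) \<in> {(i, j). i \<in> V \<and> j \<in> V \<and> i \<noteq> j \<and> S i j > 0}"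
        "(a, f a) \<notin> {(i, j). i \<in> V \<and> j \<in> V \<and> i \<noteq> j \<and> S' i j > 0}"
        using a f[of a] C CV fC by (auto simp: S'_def)
      ultimately have "{(i, j). i \<in> V \<and> j \<in> V \<and> i \<noteq> j \<and> S' i j > 0} \<subset> {(i, j). i \<in> V \<and> j \<in> V \<and> i \<noteq> j \<and> S i j > 0}"
        by blast
      then show "card {(i, j). i \<in> V \<and> j \<in> V \<and> i \<noteq> j \<and> S' i j > 0} < card {(i, j). i \<in> V \<and> j \<in> V \<and> i \<noteq> j \<and> S i j > 0}"
        by (rule psubset_card_mono[rotated]) (rule finite_subset[of _ "V \<times> V"], use fin in auto)
    qed
    moreover have "(\<Sum>i\<in>V. \<Sum>j\<in>V. S i j * d i j) = (\<Sum>i\<in>V. \<Sum>j\<in>V. S' i j * d i j) + t * (\<Sum>i\<in>V. d i (\<sigma> i))"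
    proof -
      have "(\<Sum>i\<in>V. \<Sum>j\<in>V. S' i j * d i j) = (\<Sum>i\<in>V. (\<Sum>j\<in>V. S i j * d i j) - (if i \<in> C then t * d i (f i) else 0))"
        by (intro sum.cong refl row)
      moreover have "(\<Sum>i\<in>V. if i \<in> C then t * d i (f i) else 0) = t * (\<Sum>i\<in>V. d i (\<sigma> i))"
        unfolding sum_distrib_left by (intro sum.cong refl) (auto simp: \<sigma>_def d0)
      ultimately show ?thesis by (simp add: sum_subtractf)
    qed
    ultimately show ?thesis using t d[OF perm] by simp
  qed
qed

text \<open>
This is the part of the Birkhoff--von Neumann theorem needed for Hoffman--Wielandt type estimates:
a linear functional on the doubly stochastic matrices is minimised at a permutation matrix. For a
cheapest permutation \<open>\<pi>\<close>, relabelling the columns by \<open>\<pi>\<close> turns \<open>S\<close> into a circulation,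
and the optimality of \<open>\<pi>\<close> says that rerouting along any permutation costs a nonnegative amount.
\<close>

lemma doubly_stochastic_assignment:
  fixes S c :: "'a \<Rightarrow> 'a \<Rightarrow> real"
  assumes fin: "finite V"
    and S0: "\<And>i j. i \<in> V \<Longrightarrow> j \<in> V \<Longrightarrow> S i j \<ge> 0"
    and row: "\<And>i. i \<in> V \<Longrightarrow> (\<Sum>j\<in>V. S i j) = 1"
    and col: "\<And>j. j \<in> V \<Longrightarrow> (\<Sum>i\<in>V. S i j) = 1"
  shows "\<exists>\<pi>. \<pi> permutes V \<and> (\<Sum>i\<in>V. c i (\<pi> i)) \<le> (\<Sum>i\<in>V. \<Sum>j\<in>V. S i j * c i j)"
proof -
  let ?cost = "\<lambda>\<pi>. \<Sum>i\<in>V. c i (\<pi> i)"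
  have "\<exists>\<pi>. \<pi> \<in> {\<pi>. \<pi> permutes V} \<and> (\<forall>\<pi>'\<in>{\<pi>. \<pi> permutes V}. ?cost \<pi> \<le> ?cost \<pi>')"
  proof -
    have "{\<pi>. \<pi> permutes V} \<noteq> {}" using permutes_id by blast
    from ex_is_arg_min_if_finite[OF finite_permutations[OF fin] this, of ?cost]
    show ?thesis by (auto simp: is_arg_min_linorder)
  qed
  then obtain \<pi> where \<pi>: "\<pi> permutes V" and min: "\<And>\<pi>'. \<pi>' permutes V \<Longrightarrow> ?cost \<pi> \<le> ?cost \<pi>'" by blast
  note bij = permutes_imp_bij[OF \<pi>]
  have piV: "\<pi> i \<in> V" if "i \<in> V" for i using that \<pi> by (simp add: permutes_in_image)
  have "0 \<le> (\<Sum>i\<in>V. \<Sum>j\<in>V. S i (\<pi> j) * (c i (\<pi> j) - c i (\<pi> i)))"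
  proof (rule circulation_cost_nonneg[OF fin])
    show "(\<Sum>j\<in>V. S i (\<pi> j)) = (\<Sum>j\<in>V. S j (\<pi> i))" if "i \<in> V" for i
      using sum.reindex_bij_betw[OF bij, of "S i"] row[OF that] col[OF piV[OF that]] by simp
    show "0 \<le> (\<Sum>i\<in>V. c i (\<pi> (\<sigma> i)) - c i (\<pi> i))" if "\<sigma> permutes V" for \<sigma>
      using min[OF permutes_compose[OF that \<pi>]] by (simp add: sum_subtractf)
  qed (use S0 piV in auto)
  also have "\<dots> = (\<Sum>i\<in>V. \<Sum>j\<in>V. S i j * (c i j - c i (\<pi> i)))"
  proof (rule sum.cong[OF refl])
    fix i
    show "(\<Sum>j\<in>V. S i (\<pi> j) * (c i (\<pi> j) - c i (\<pi> i))) = (\<Sum>j\<in>V. S i j * (c i j - c i (\<pi> i)))"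
      by (rule sum.reindex_bij_betw[OF bij])
  qed
  also have "\<dots> = (\<Sum>i\<in>V. \<Sum>j\<in>V. S i j * c i j) - (\<Sum>i\<in>V. (\<Sum>j\<in>V. S i j) * c i (\<pi> i))"
    by (simp add: right_diff_distrib sum_subtractf sum_distrib_right)
  finally show ?thesis using \<pi> row by auto
qed

text \<open>
Weighting the \<open>i\<close>-th balance equation by \<open>i\<close> and adding up gives
\<open>\<Sum>i j. (j - i) * y i j = 0\<close>. Above the diagonal the factor \<open>j - i\<close> is at least 1, below
it is at least \<open>-(n - 1)\<close>.
\<close>

lemma balanced_upper_le_lower:
  fixes y :: "nat \<Rightarrow> nat \<Rightarrow> real"
  assumes y0: "\<And>i j. i < n \<Longrightarrow> j < n \<Longrightarrow> y i j \<ge> 0"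
    and bal: "\<And>i. i < n \<Longrightarrow> (\<Sum>j<n. y i j) = (\<Sum>j<n. y j i)"
  shows "(\<Sum>i<n. \<Sum>j<n. if i < j then y i j else 0)
     \<le> (real n - 1) * (\<Sum>i<n. \<Sum>j<n. if j < i then y i j else 0)"
proof -
  have "(\<Sum>i<n. \<Sum>j<n. real i * y i j) = (\<Sum>i<n. \<Sum>j<n. real i * y j i)"
    using bal by (simp flip: sum_distrib_left)
  also have "\<dots> = (\<Sum>i<n. \<Sum>j<n. real j * y i j)" by (rule sum.swap)
  finally have "(\<Sum>i<n. \<Sum>j<n. (real j - real i) * y i j) = 0"
    by (simp add: left_diff_distrib sum_subtractf)
  moreover have "(\<Sum>i<n. \<Sum>j<n. if i < j then y i j else 0)
      \<le> (\<Sum>i<n. \<Sum>j<n. (real j - real i) * y i j + (real n - 1) * (if j < i then y i j else 0))"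
  proof (intro sum_mono)
    fix i j assume "i \<in> {..<n}" "j \<in> {..<n}"
    then have ij: "i < n" "j < n" by auto
    have "y i j \<le> (real j - real i) * y i j" if "i < j"
      using mult_right_mono[of 1 "real j - real i" "y i j"] that y0[OF ij] by simp
    moreover have "(real i - real j) * y i j \<le> (real n - 1) * y i j"
      using y0[OF ij] ij by (intro mult_right_mono) auto
    ultimately show "(if i < j then y i j else 0) \<le> (real j - real i) * y i j + (real n - 1) * (if j < i then y i j else 0)"
      by (cases i j rule: linorder_cases) (auto simp: left_diff_distrib)
  qed
  ultimately show ?thesis by (simp add: sum.distrib sum_distrib_left)
qed

section \<open>Adjoints, unitary matrices and the Frobenius norm\<close>

lemma cmod_sq: "z * cnj z = (of_real (cmod z))\<^sup>2" "cnj z * z = (of_real (cmod z))\<^sup>2"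
  using complex_norm_square[of z] by (simp_all add: mult.commute)

lemma mat_adjoint_carrier [simp]:
  "A \<in> carrier_mat m n \<Longrightarrow> mat_adjoint A \<in> carrier_mat n m"
  by (auto simp: mat_adjoint_def mat_of_rows_def)

lemma mat_adjoint_dim [simp]: 
  "dim_row (mat_adjoint A) = dim_col A" "dim_col (mat_adjoint A) = dim_row A"
  by (auto simp: mat_adjoint_def mat_of_rows_def)

lemma mat_adjoint_index [simp]:
  fixes A :: "complex mat"
  shows "i < dim_col A \<Longrightarrow> j < dim_row A \<Longrightarrow> mat_adjoint A $$ (i, j) = cnj (A $$ (j, i))"
  by (simp add: mat_adjoint_def mat_of_rows_def)

lemma mat_adjoint_adjoint [simp]: "mat_adjoint (mat_adjoint A) = (A :: complex mat)"
  by (rule eq_matI) auto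

lemma mat_adjoint_mult:
  fixes A B :: "complex mat"
  assumes "A \<in> carrier_mat m k" "B \<in> carrier_mat k n"
  shows "mat_adjoint (A * B) = mat_adjoint B * mat_adjoint A"
  by (rule eq_matI) (use assms in \<open>auto simp: scalar_prod_def intro!: sum.cong\<close>)

lemma mat_trace_comm:
  assumes "A \<in> carrier_mat m n" "B \<in> carrier_mat n m"
  shows "mat_trace (A * B) = mat_trace (B * A)"
proof -
  have "mat_trace (A * B) = (\<Sum>i<m. \<Sum>j<n. A $$ (i, j) * B $$ (j, i))"
    using assms by (auto simp: mat_trace_def scalar_prod_def atLeast0LessThan)
  also have "\<dots> = (\<Sum>j<n. \<Sum>i<m. A $$ (i, j) * B $$ (j, i))" by (rule sum.swap)
  also have "\<dots> = mat_trace (B * A)"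
    using assms by (auto simp: mat_trace_def scalar_prod_def atLeast0LessThan mult.commute)
  finally show ?thesis .
qed

lemma mat_trace_conj:
  assumes "P \<in> carrier_mat n n" "Q \<in> carrier_mat n n" "A \<in> carrier_mat n n" "P * Q = 1\<^sub>m n"
  shows "mat_trace (Q * A * P) = mat_trace A"
proof -
  have "mat_trace (Q * A * P) = mat_trace (P * (Q * A))"
    by (rule mat_trace_comm) (use assms in auto)
  also have "P * (Q * A) = A" using assms by (simp flip: assoc_mult_mat)
  finally show ?thesis .
qed

lemma frob_norm_nonneg: "frob_norm A \<ge> 0"
  unfolding frob_norm_def by (intro real_sqrt_ge_zero sum_nonneg) auto

lemma frob_norm_sq:
  assumes "A \<in> carrier_mat m n"
  shows "(frob_norm A)\<^sup>2 = (\<Sum>i<m. \<Sum>j<n. (cmod (A $$ (i, j)))\<^sup>2)"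
proof -
  have "(\<Sum>i<m. \<Sum>j<n. (cmod (A $$ (i, j)))\<^sup>2) \<ge> 0" by (intro sum_nonneg) auto
  then show ?thesis using assms by (simp add: frob_norm_def)
qed

lemma adjoint_mult_diag:
  assumes "A \<in> carrier_mat m n" "j < n"
  shows "(mat_adjoint A * A) $$ (j, j) = of_real (\<Sum>i<m. (cmod (A $$ (i, j)))\<^sup>2)"
  using assms by (auto simp: scalar_prod_def atLeast0LessThan cmod_sq intro!: sum.cong)

lemma mult_adjoint_diag:
  assumes "A \<in> carrier_mat m n" "i < m"
  shows "(A * mat_adjoint A) $$ (i, i) = of_real (\<Sum>j<n. (cmod (A $$ (i, j)))\<^sup>2)"
  using assms by (auto simp: scalar_prod_def atLeast0LessThan cmod_sq intro!: sum.cong)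

text \<open>
Through this identity the unitary invariance of the Frobenius norm becomes plain matrix algebra.
\<close>

lemma frob_norm_sq_trace:
  assumes "A \<in> carrier_mat m n"
  shows "of_real ((frob_norm A)\<^sup>2) = mat_trace (mat_adjoint A * A)"
proof -
  have "mat_trace (mat_adjoint A * A) = (\<Sum>j<n. of_real (\<Sum>i<m. (cmod (A $$ (i, j)))\<^sup>2))"
    unfolding mat_trace_def using assms adjoint_mult_diag[OF assms] by (intro sum.cong) (auto simp del: index_mult_mat(1))
  then show ?thesis
    unfolding frob_norm_sq[OF assms] by (subst sum.swap) (simp flip: of_real_sum)
qed

definition unitary_mat :: "nat \<Rightarrow> complex mat \<Rightarrow> bool" where
  "unitary_mat n U \<longleftrightarrow> U \<in> carrier_mat n n \<and> mat_adjoint U * U = 1\<^sub>m n \<and> U * mat_adjoint U = 1\<^sub>m n"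

lemma unitary_matI:
  assumes "U \<in> carrier_mat n n" "mat_adjoint U * U = 1\<^sub>m n"
  shows "unitary_mat n U"
  using assms mat_mult_left_right_inverse[of "mat_adjoint U" n U] by (simp add: unitary_mat_def)

lemma unitary_adjoint: "unitary_mat n U \<Longrightarrow> unitary_mat n (mat_adjoint U)"
  by (simp add: unitary_mat_def)

lemma frob_norm_unitary_left:
  assumes U: "unitary_mat n U" and A: "A \<in> carrier_mat n k"
  shows "frob_norm (U * A) = frob_norm A"
proof -
  have Uc: "U \<in> carrier_mat n n" "mat_adjoint U * U = 1\<^sub>m n" using U by (auto simp: unitary_mat_def)
  have "mat_adjoint (U * A) * (U * A) = mat_adjoint A * (mat_adjoint U * U) * A"
    using Uc(1) A by (simp add: mat_adjoint_mult[OF Uc(1) A] assoc_mult_mat[of _ k n _ n _ k]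
      assoc_mult_mat[of _ n n _ n _ k] mult_carrier_mat[of _ n n _ n] mult_carrier_mat[of _ n n _ k])
  also have "\<dots> = mat_adjoint A * A" using A Uc by simp
  finally have "mat_trace (mat_adjoint (U * A) * (U * A)) = mat_trace (mat_adjoint A * A)" by simp
  then have "(frob_norm (U * A))\<^sup>2 = (frob_norm A)\<^sup>2"
    using frob_norm_sq_trace[OF mult_carrier_mat[OF Uc(1) A]] frob_norm_sq_trace[OF A]
    by (metis of_real_eq_iff)
  then show ?thesis by (simp add: frob_norm_nonneg)
qed

lemma frob_norm_adjoint [simp]: "frob_norm (mat_adjoint A) = frob_norm A"
  unfolding frob_norm_def by (subst sum.swap) simp

lemma frob_norm_unitary_right:
  assumes U: "unitary_mat n U" and A: "A \<in> carrier_mat k n"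
  shows "frob_norm (A * U) = frob_norm A"
proof -
  have Uc: "U \<in> carrier_mat n n" using U by (auto simp: unitary_mat_def)
  have "frob_norm (A * U) = frob_norm (mat_adjoint U * mat_adjoint A)"
    by (metis frob_norm_adjoint mat_adjoint_mult[OF A Uc])
  then show ?thesis using frob_norm_unitary_left[OF unitary_adjoint[OF U], of "mat_adjoint A" k] A by simp
qed

text \<open>
Complete the vector to a basis, orthogonalise it, and normalise the columns; Gram--Schmidt leaves
the direction of the first vector unchanged.
\<close>

lemma unitary_with_first_column:
  fixes v :: "complex vec"
  assumes v: "v \<in> carrier_vec n" "v \<noteq> 0\<^sub>v n" and n: "n \<noteq> 0"
  shows "\<exists>W a. unitary_mat n W \<and> col W 0 = a \<cdot>\<^sub>v v"
proof -
  interpret cof_vec_space n "TYPE(complex)" .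
  define b where "b = basis_completion v"
  define ws where "ws = gram_schmidt n b"
  note bc = basis_completion[OF v, folded b_def]
  obtain vs where bv: "b = v # vs" using bc(6,7) n by (cases b) auto
  note gs = gram_schmidt_result[OF bc(2,4,5) refl, folded ws_def]
  have hd: "ws ! 0 = v" 
    using gram_schmidt_hd[OF v(1), of vs, folded bv ws_def] gs(4) bc(6) n by (cases ws) auto
  have len: "length ws = n" using gs(4) bc(6) by simp
  have wc: "ws ! i \<in> carrier_vec n" if "i < n" for i using gs(3) len that by auto
  define r where "r i = sqrt (\<Sum>k<n. (cmod (ws ! i $ k))\<^sup>2)" for i
  have sp: "ws ! i \<bullet>c ws ! i = of_real ((r i)\<^sup>2)" if "i < n" for i
  proof -
    have "(r i)\<^sup>2 = (\<Sum>k<n. (cmod (ws ! i $ k))\<^sup>2)" unfolding r_def by (simp add: sum_nonneg)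
    then show ?thesis using wc[OF that]
      by (auto simp: scalar_prod_def atLeast0LessThan cmod_sq intro!: sum.cong)
  qed
  have orth: "(ws ! i \<bullet>c ws ! j = 0) = (i \<noteq> j)" if "i < n" "j < n" for i j
    using corthogonalD[OF gs(2)] that len by auto
  have r0: "r i \<noteq> 0" if "i < n" for i using sp[OF that] orth[OF that that] by auto
  define W where "W = mat n n (\<lambda>(k, i). ws ! i $ k / of_real (r i))"
  have "mat_adjoint W * W = 1\<^sub>m n"
  proof (rule eq_matI)
    fix i j assume "i < dim_row (1\<^sub>m n)" "j < dim_col (1\<^sub>m n)"
    then have ij: "i < n" "j < n" by auto
    have "(mat_adjoint W * W) $$ (i, j) = (\<Sum>k<n. cnj (ws ! i $ k / of_real (r i)) * (ws ! j $ k / of_real (r j)))"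
      using ij by (auto simp: W_def scalar_prod_def atLeast0LessThan intro!: sum.cong)
    also have "\<dots> = (\<Sum>k<n. ws ! j $ k * cnj (ws ! i $ k)) / of_real (r i * r j)"
      by (simp add: sum_divide_distrib mult.commute)
    also have "(\<Sum>k<n. ws ! j $ k * cnj (ws ! i $ k)) = ws ! j \<bullet>c ws ! i"
      using wc[OF ij(1)] wc[OF ij(2)] by (auto simp: scalar_prod_def atLeast0LessThan intro!: sum.cong)
    also have "\<dots> / of_real (r i * r j) = (1\<^sub>m n $$ (i, j) :: complex)"
      using orth[OF ij(2,1)] sp[OF ij(1)] r0[OF ij(1)] ij by (auto simp: power2_eq_square)
    finally show "(mat_adjoint W * W) $$ (i, j) = 1\<^sub>m n $$ (i, j)" .
  qed (auto simp: W_def)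
  then have "unitary_mat n W" by (rule unitary_matI[rotated]) (simp add: W_def)
  moreover have "col W 0 = (1 / of_real (r 0)) \<cdot>\<^sub>v v"
    using n v hd by (intro eq_vecI) (auto simp: W_def)
  ultimately show ?thesis by blast
qed

lemma unitary_mult:
  assumes "unitary_mat n U" "unitary_mat n V"
  shows "unitary_mat n (U * V)"
proof (rule unitary_matI)
  have c: "U \<in> carrier_mat n n" "V \<in> carrier_mat n n" "mat_adjoint U * U = 1\<^sub>m n" "mat_adjoint V * V = 1\<^sub>m n"
    using assms by (auto simp: unitary_mat_def)
  show "U * V \<in> carrier_mat n n" using c by simp
  have "mat_adjoint (U * V) * (U * V) = mat_adjoint V * (mat_adjoint U * U) * V"
    using c(1,2) by (simp add: mat_adjoint_mult[OF c(1,2)] assoc_mult_mat[of _ n n _ n _ n]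
      mult_carrier_mat[of _ n n _ n])
  then show "mat_adjoint (U * V) * (U * V) = 1\<^sub>m n" using c by simp
qed

lemma unitary_bordered:
  assumes "unitary_mat k P"
  shows "unitary_mat (Suc k) (four_block_mat (1\<^sub>m 1) (0\<^sub>m 1 k) (0\<^sub>m k 1) P)" (is "unitary_mat _ ?F")
    and "mat_adjoint (four_block_mat (1\<^sub>m 1) (0\<^sub>m 1 k) (0\<^sub>m k 1) P)
       = four_block_mat (1\<^sub>m 1) (0\<^sub>m 1 k) (0\<^sub>m k 1) (mat_adjoint P)"
proof -
  have P: "P \<in> carrier_mat k k" "mat_adjoint P * P = 1\<^sub>m k" using assms by (auto simp: unitary_mat_def)
  show adj: "mat_adjoint ?F = four_block_mat (1\<^sub>m 1) (0\<^sub>m 1 k) (0\<^sub>m k 1) (mat_adjoint P)"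
    by (rule eq_matI) (use P(1) in auto)
  have "mat_adjoint ?F * ?F = four_block_mat (1\<^sub>m 1) (0\<^sub>m 1 k) (0\<^sub>m k 1) (1\<^sub>m k)"
    unfolding adj by (subst mult_four_block_mat[of _ 1 1 _ k _ k _ _ 1 _ k]) (use P in auto)
  also have "\<dots> = 1\<^sub>m (Suc k)" by (rule eq_matI) auto
  finally show "unitary_mat (Suc k) ?F" by (intro unitary_matI) (use P in auto)
qed

section \<open>Schur form and the distance to a normal matrix\<close>

text \<open>
Schur's theorem, by deflation: a unitary matrix whose first column is an eigenvector clears the
first column below the diagonal, and the remaining block is smaller. The triangularisation has to
be unitary, and not just a similarity, so that it preserves the Frobenius norm.
\<close>

lemma unitary_schur:
  assumes "A \<in> carrier_mat n n"
  shows "\<exists>U. unitary_mat n U \<and> upper_triangular (mat_adjoint U * A * U)"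
  using assms
proof (induction n arbitrary: A)
  case 0
  then show ?case by (intro exI[of _ "1\<^sub>m 0"]) (auto simp: unitary_mat_def)
next
  case (Suc k)
  note A = Suc.prems
  obtain es where es: "char_poly A = (\<Prod>e\<leftarrow>es. [:- e, 1:])" "length es = Suc k"
    using char_poly_factorized[OF A] by auto
  then obtain e es' where "es = e # es'" by (cases es) auto
  then have "poly (char_poly A) e = 0" by (simp add: es)
  then obtain v where "eigenvector A v e"
    using eigenvalue_root_char_poly[OF A] by (auto simp: eigenvalue_def)
  then have v: "v \<in> carrier_vec (Suc k)" "v \<noteq> 0\<^sub>v (Suc k)" "A *\<^sub>v v = e \<cdot>\<^sub>v v"
    using A by (auto simp: eigenvector_def)
  obtain W a where W: "unitary_mat (Suc k) W" and a: "col W 0 = a \<cdot>\<^sub>v v"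
    using unitary_with_first_column[OF v(1,2)] by auto
  have Wc: "W \<in> carrier_mat (Suc k) (Suc k)" "mat_adjoint W * W = 1\<^sub>m (Suc k)"
    using W by (auto simp: unitary_mat_def)
  define B where "B = mat_adjoint W * A * W"
  have B: "B \<in> carrier_mat (Suc k) (Suc k)"
    unfolding B_def using A Wc by (meson mat_adjoint_carrier mult_carrier_mat)
  have "A *\<^sub>v col W 0 = e \<cdot>\<^sub>v col W 0"
    using v A by (simp add: a mult_mat_vec[of _ "Suc k" "Suc k"] smult_smult_assoc mult.commute)
  moreover have "col B 0 = mat_adjoint W *\<^sub>v (A *\<^sub>v col W 0)"
  proof -
    have "B = mat_adjoint W * (A * W)"
      unfolding B_def by (rule assoc_mult_mat[of _ "Suc k" "Suc k" _ "Suc k" _ "Suc k"]) (use A Wc in auto)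
    then show ?thesis
      using col_mult2[OF mat_adjoint_carrier[OF Wc(1)] mult_carrier_mat[OF A Wc(1)], of 0]
        col_mult2[OF A Wc(1), of 0] by (simp only: zero_less_Suc)
  qed
  ultimately have "col B 0 = e \<cdot>\<^sub>v (mat_adjoint W *\<^sub>v col W 0)"
    using Wc by (simp add: mult_mat_vec[of _ "Suc k" "Suc k"] col_carrier_vec[of 0 "Suc k"])
  also have "mat_adjoint W *\<^sub>v col W 0 = col (1\<^sub>m (Suc k)) 0"
    using Wc by (simp flip: Wc(2) add: col_mult2[of _ "Suc k" "Suc k" _ "Suc k"])
  finally have col0: "col B 0 = e \<cdot>\<^sub>v col (1\<^sub>m (Suc k)) 0" .
  have B0: "B $$ (Suc i, 0) = 0" if "i < k" for i
    using arg_cong[OF col0, of "\<lambda>w. w $ Suc i"] that B by simp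
  define B1 where "B1 = mat 1 1 (\<lambda>_. B $$ (0, 0))"
  define B2 where "B2 = mat 1 k (\<lambda>(_, j). B $$ (0, Suc j))"
  define B3 where "B3 = mat k k (\<lambda>(i, j). B $$ (Suc i, Suc j))"
  have B_block: "B = four_block_mat B1 B2 (0\<^sub>m k 1) B3"
  proof (rule eq_matI)
    fix i j assume "i < dim_row (four_block_mat B1 B2 (0\<^sub>m k 1) B3)" "j < dim_col (four_block_mat B1 B2 (0\<^sub>m k 1) B3)"
    then show "B $$ (i, j) = four_block_mat B1 B2 (0\<^sub>m k 1) B3 $$ (i, j)"
      using B0 by (cases i; cases j) (auto simp: B1_def B2_def B3_def)
  qed (use B in \<open>auto simp: B1_def B2_def B3_def\<close>)
  have Bc: "B1 \<in> carrier_mat 1 1" "B2 \<in> carrier_mat 1 k" "B3 \<in> carrier_mat k k"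
    by (auto simp: B1_def B2_def B3_def)
  obtain P where P: "unitary_mat k P" "upper_triangular (mat_adjoint P * B3 * P)"
    using Suc.IH[OF Bc(3)] by auto
  have Pc: "P \<in> carrier_mat k k" using P by (simp add: unitary_mat_def)
  define F where "F = four_block_mat (1\<^sub>m 1) (0\<^sub>m 1 k) (0\<^sub>m k 1) P"
  have F: "unitary_mat (Suc k) F" unfolding F_def by (rule unitary_bordered(1)[OF P(1)])
  have Fc: "F \<in> carrier_mat (Suc k) (Suc k)" using F by (simp add: unitary_mat_def)
  have PB: "mat_adjoint P * B3 \<in> carrier_mat k k" "mat_adjoint P * B3 * P \<in> carrier_mat k k"
    using Pc Bc by (meson mat_adjoint_carrier mult_carrier_mat)+
  have "mat_adjoint F * B = four_block_mat B1 B2 (0\<^sub>m k 1) (mat_adjoint P * B3)"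
    unfolding F_def unitary_bordered(2)[OF P(1)] B_block
    by (subst mult_four_block_mat[of _ 1 1 _ k _ k _ _ 1 _ k]) (use Pc Bc PB in auto)
  then have "mat_adjoint F * B * F = four_block_mat B1 (B2 * P) (0\<^sub>m k 1) (mat_adjoint P * B3 * P)"
    unfolding F_def
    by (simp, subst mult_four_block_mat[of _ 1 1 _ k _ k _ _ 1 _ k])
      (use Pc Bc PB mult_carrier_mat[OF Bc(2) Pc] in auto)
  moreover have "upper_triangular B1" by (auto simp: B1_def)
  ultimately have "upper_triangular (mat_adjoint F * B * F)"
    using upper_triangular_four_block[OF Bc(1) PB(2) _ P(2)] by simp
  also have "mat_adjoint F * B * F = mat_adjoint (W * F) * A * (W * F)"
  proof -
    have "G * (V * A * W) * F = G * V * A * (W * F)"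
      if "G \<in> carrier_mat (Suc k) (Suc k)" "V \<in> carrier_mat (Suc k) (Suc k)" for G V
      using that Fc Wc(1) A
      by (simp add: assoc_mult_mat[of _ "Suc k" "Suc k" _ "Suc k" _ "Suc k"]
        mult_carrier_mat[of _ "Suc k" "Suc k" _ "Suc k"])
    then show ?thesis unfolding B_def mat_adjoint_mult[OF Wc(1) Fc] using Fc Wc(1) by simp
  qed
  finally show ?case using unitary_mult[OF W F] by blast
qed

lemma order_char_poly_upper_triangular:
  fixes T :: "complex mat"
  assumes T: "T \<in> carrier_mat n n" "upper_triangular T"
  shows "Polynomial.order z (char_poly T) = card {i \<in> {..<n}. T $$ (i, i) = z}"
proof -
  have lin: "Polynomial.order z [:- a, 1:] = (if a = z then 1 else 0)" for a :: complex
    using order_power_n_n[of a 1] order_0I[of "[:- a, 1:]" z] by auto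
  have "Polynomial.order z (char_poly T) = (\<Sum>i\<leftarrow>[0..<n]. if T $$ (i, i) = z then 1 else 0)"
    unfolding char_poly_upper_triangular[OF T] using T(1)
    by (subst order_prod_list) (auto simp: diag_mat_def o_def lin)
  also have "\<dots> = (\<Sum>i<n. if T $$ (i, i) = z then 1 else 0)"
    by (simp add: interv_sum_list_conv_sum_set_nat atLeast0LessThan)
  finally show ?thesis by (simp flip: sum.inter_filter)
qed

text \<open>
The indices of an enumerated spectrum start at 1 and those of a matrix at 0; the bijection
\<open>\<sigma>\<close> translates between them while it matches equal values.
\<close>

lemma lists_spectrum_eq_diagonal:
  assumes Y: "Y \<in> carrier_mat n n" "lists_spectrum Y l"
    and T: "T \<in> carrier_mat n n" "upper_triangular T" "char_poly Y = char_poly T"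
  shows "\<exists>\<sigma>. bij_betw \<sigma> {..<n} {1..n} \<and> (\<forall>i<n. l (\<sigma> i) = T $$ (i, i))"
proof -
  have bij: "bij_betw Suc {..<n} {1..n}" 
    by (simp add: bij_betw_def image_Suc_lessThan)
  define t where "t k = T $$ (k - 1, k - 1)" for k
  have "card {k \<in> {1..n}. t k = z} = card {k \<in> {1..n}. l k = z}" for z
  proof -
    have "bij_betw Suc {i \<in> {..<n}. T $$ (i, i) = z} {k \<in> {1..n}. t k = z}"
      unfolding t_def by (rule bij_betwI[of _ _ _ "\<lambda>k. k - 1"]) auto
    from bij_betw_same_card[OF this] show ?thesis
      using order_char_poly_upper_triangular[OF T(1,2)] Y T(3) by (simp add: lists_spectrum_def)
  qed
  then have "image_mset t (mset_set {1..n}) = image_mset l (mset_set {1..n})"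
    by (intro multiset_eqI) (simp add: count_image_mset_eq_card_vimage)
  then obtain p where p: "p permutes {1..n}" "\<forall>k\<in>{1..n}. t k = l (p k)"
    using image_mset_eq_implies_permutes[of "{1..n}" t l] by auto
  have "bij_betw (p \<circ> Suc) {..<n} {1..n}"
    by (rule bij_betw_trans[OF bij permutes_imp_bij[OF p(1)]])
  moreover have "l ((p \<circ> Suc) i) = T $$ (i, i)" if "i < n" for i
    using bspec[OF p(2), of "Suc i"] that by (simp add: t_def)
  ultimately show ?thesis by blast
qed

text \<open>
The matrix \<open>X\<close> is normal, and the diagonal entries of \<open>X * mat_adjoint X = mat_adjoint X * X\<close>
are the squared norms of its rows and of its columns.
\<close>

lemma unitary_conj_diag_balanced:
  fixes d :: "nat \<Rightarrow> complex"
  assumes U: "unitary_mat n U" and i: "i < n"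
  defines "X \<equiv> mat_adjoint U * mat_diag n d * U"
  shows "(\<Sum>j<n. (cmod (X $$ (i, j)))\<^sup>2) = (\<Sum>j<n. (cmod (X $$ (j, i)))\<^sup>2)"
proof -
  have Uc: "U \<in> carrier_mat n n" "U * mat_adjoint U = 1\<^sub>m n" using U by (auto simp: unitary_mat_def)
  have Ac: "mat_adjoint U \<in> carrier_mat n n" using Uc by simp
  note m = mult_carrier_mat[of _ n n _ n]
  note assoc = assoc_mult_mat[of _ n n _ n _ n]
  have X: "X \<in> carrier_mat n n" unfolding X_def using Uc Ac by (intro m) auto
  let ?D = "mat_diag n d" and ?D' = "mat_diag n (\<lambda>i. cnj (d i))"
  have adjD: "mat_adjoint ?D = ?D'" by (rule eq_matI) (auto simp: mat_diag_def)
  have adjX: "mat_adjoint X = mat_adjoint U * ?D' * U"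
    unfolding X_def using Uc Ac
    by (simp add: mat_adjoint_mult[of _ n n _ n] m adjD assoc)
  have conj_mult: "(mat_adjoint U * M * U) * (mat_adjoint U * N * U) = mat_adjoint U * (M * N) * U"
    if "M \<in> carrier_mat n n" "N \<in> carrier_mat n n" for M N
  proof -
    have "(mat_adjoint U * M * U) * (mat_adjoint U * N * U) = mat_adjoint U * M * (U * mat_adjoint U) * N * U"
      using that Uc(1) Ac by (simp add: assoc m)
    then show ?thesis using that Uc Ac by (simp add: assoc m)
  qed
  have "X * mat_adjoint X = mat_adjoint X * X"
    unfolding adjX unfolding X_def by (simp add: conj_mult mult.commute)
  then have "(of_real (\<Sum>j<n. (cmod (X $$ (i, j)))\<^sup>2) :: complex) = of_real (\<Sum>j<n. (cmod (X $$ (j, i)))\<^sup>2)"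
    using mult_adjoint_diag[OF X i] adjoint_mult_diag[OF X i] by simp
  then show ?thesis by (simp only: of_real_eq_iff)
qed

text \<open>
Sun's extension of the Hoffman--Wielandt theorem to one normal and one arbitrary matrix, with the
arbitrary matrix already in Schur form. Let \<open>D\<close> be the diagonal part of \<open>T\<close> and \<open>X\<close> the normal
matrix. The squares \<open>|U k j|\<^sup>2\<close> form a doubly stochastic matrix for which the expected cost is
\<open>\<parallel>D - X\<parallel>\<^sup>2\<close>, so some permutation does at least as well. Below the diagonal \<open>X\<close> agrees with
\<open>X - T\<close>, and the part of \<open>X\<close> above the diagonal, where \<open>T\<close> is out of control, is at most
\<open>n - 1\<close> times the part below. Hence \<open>\<parallel>D - X\<parallel>\<^sup>2 \<le> n * \<parallel>T - X\<parallel>\<^sup>2\<close>.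
\<close>

lemma triangular_diag_distance:
  assumes U: "unitary_mat n U" and T: "T \<in> carrier_mat n n" "upper_triangular T"
  shows "\<exists>\<pi>. \<pi> permutes {..<n} \<and> (\<Sum>i<n. (cmod (T $$ (\<pi> i, \<pi> i) - d i))\<^sup>2)
     \<le> real n * (frob_norm (T - mat_adjoint U * mat_diag n d * U))\<^sup>2"
proof -
  have Uc: "U \<in> carrier_mat n n" "U * mat_adjoint U = 1\<^sub>m n" "mat_adjoint U * U = 1\<^sub>m n"
    using U by (auto simp: unitary_mat_def)
  have Ac: "mat_adjoint U \<in> carrier_mat n n" using Uc by simp
  define X where "X = mat_adjoint U * mat_diag n d * U"
  have X: "X \<in> carrier_mat n n" unfolding X_def using Uc Ac by (intro mult_carrier_mat[of _ n n _ n]) auto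
  define D where "D = mat_diag n (\<lambda>j. T $$ (j, j))"
  have D: "D \<in> carrier_mat n n" by (simp add: D_def)
  let ?c = "\<lambda>k j. (cmod (T $$ (j, j) - d k))\<^sup>2"
  let ?S = "\<lambda>k j. (cmod (U $$ (k, j)))\<^sup>2"
  have row: "(\<Sum>j<n. ?S k j) = 1" if "k < n" for k
    using mult_adjoint_diag[OF Uc(1) that] Uc that by (simp flip: of_real_sum of_real_power add: of_real_eq_1_iff)
  have col: "(\<Sum>k<n. ?S k j) = 1" if "j < n" for j
    using adjoint_mult_diag[OF Uc(1) that] Uc that by (simp flip: of_real_sum of_real_power add: of_real_eq_1_iff)
  obtain \<pi> where \<pi>: "\<pi> permutes {..<n}" "(\<Sum>k<n. ?c k (\<pi> k)) \<le> (\<Sum>k<n. \<Sum>j<n. ?S k j * ?c k j)"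
    using doubly_stochastic_assignment[of "{..<n}" ?S ?c] row col by auto
  have "(\<Sum>k<n. \<Sum>j<n. ?S k j * ?c k j) = (frob_norm (U * D - mat_diag n d * U))\<^sup>2"
  proof -
    have "U * D - mat_diag n d * U = mat n n (\<lambda>(k, j). U $$ (k, j) * (T $$ (j, j) - d k))"
      unfolding D_def mat_diag_mult_right[OF Uc(1)] mat_diag_mult_left[OF Uc(1)]
      by (rule eq_matI) (auto simp: algebra_simps)
    then show ?thesis
      by (subst frob_norm_sq[of _ n n]) (auto simp: norm_mult power_mult_distrib)
  qed
  also have "frob_norm (U * D - mat_diag n d * U) = frob_norm (mat_adjoint U * (U * D - mat_diag n d * U))"
    by (rule frob_norm_unitary_left[OF unitary_adjoint[OF U], symmetric, of _ n])
      (use Uc D in \<open>auto intro!: minus_carrier_mat mult_carrier_mat[of _ n n _ n]\<close>)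
  also have "mat_adjoint U * (U * D - mat_diag n d * U) = D - X"
  proof -
    have "mat_adjoint U * (U * D - mat_diag n d * U) = mat_adjoint U * (U * D) - mat_adjoint U * (mat_diag n d * U)"
      by (rule mult_minus_distrib_mat[of _ n n _ n]) (use Uc D in \<open>auto intro!: mult_carrier_mat[of _ n n _ n]\<close>)
    also have "mat_adjoint U * (U * D) = D"
      using Uc Ac D assoc_mult_mat[of "mat_adjoint U" n n U n D n] by simp
    also have "mat_adjoint U * (mat_diag n d * U) = X"
      unfolding X_def by (rule assoc_mult_mat[symmetric, of _ n n _ n _ n]) (use Uc in auto)
    finally show ?thesis .
  qed
  also have "(frob_norm (D - X))\<^sup>2 \<le> real n * (frob_norm (T - X))\<^sup>2"
  proof -
    let ?x = "\<lambda>i j. (cmod (X $$ (i, j)))\<^sup>2"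
    let ?L = "\<Sum>i<n. \<Sum>j<n. if j < i then ?x i j else 0"
    let ?R = "\<Sum>i<n. \<Sum>j<n. if i < j then ?x i j else 0"
    let ?E = "\<Sum>i<n. \<Sum>j<n. if i = j then (cmod (T $$ (i, j) - X $$ (i, j)))\<^sup>2 else 0"
    have "(frob_norm (D - X))\<^sup>2 = (\<Sum>i<n. \<Sum>j<n. (cmod (D $$ (i, j) - X $$ (i, j)))\<^sup>2)"
      using X D by (subst frob_norm_sq[of _ n n]) auto
    also have "\<dots> = ?E + ?L + ?R"
      unfolding sum.distrib[symmetric] by (intro sum.cong refl) (auto simp: D_def mat_diag_def)
    finally have split: "(frob_norm (D - X))\<^sup>2 = ?E + ?L + ?R" .
    have R: "?R \<le> (real n - 1) * ?L"
      by (rule balanced_upper_le_lower) (use unitary_conj_diag_balanced[OF U] in \<open>auto simp: X_def\<close>)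
    have E: "?E \<le> real n * ?E"
    proof (cases "n = 0")
      case False
      then have "1 * ?E \<le> real n * ?E" by (intro mult_right_mono sum_nonneg) auto
      then show ?thesis by simp
    qed simp
    have "(frob_norm (T - X))\<^sup>2 = (\<Sum>i<n. \<Sum>j<n. (cmod (T $$ (i, j) - X $$ (i, j)))\<^sup>2)"
      using X T by (subst frob_norm_sq[of _ n n]) auto
    moreover have "?E + ?L \<le> (\<Sum>i<n. \<Sum>j<n. (cmod (T $$ (i, j) - X $$ (i, j)))\<^sup>2)"
      unfolding sum.distrib[symmetric] using T by (intro sum_mono) (auto dest: upper_triangularD)
    ultimately have "real n * (?E + ?L) \<le> real n * (frob_norm (T - X))\<^sup>2"
      by (intro mult_left_mono) auto
    with split R E show ?thesis by (simp add: algebra_simps)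
  qed
  finally show ?thesis using \<pi> unfolding X_def by (meson order_trans)
qed

section \<open>Spectral variation of a diagonal matrix\<close>

lemma sum_cmod_sq_shift:
  fixes z :: "nat \<Rightarrow> complex"
  assumes n: "n \<ge> 1"
  defines "c \<equiv> (\<Sum>i<n. z i) / of_nat n"
  shows "(\<Sum>i<n. (cmod (z i))\<^sup>2) = (\<Sum>i<n. (cmod (z i - c))\<^sup>2) + (cmod (\<Sum>i<n. z i))\<^sup>2 / real n"
proof -
  have sum_z: "(\<Sum>i<n. z i) = of_nat n * c" using n by (simp add: c_def)
  have "(\<Sum>i<n. (cmod (z i - c))\<^sup>2) = (\<Sum>i<n. (cmod (z i))\<^sup>2 + (cmod c)\<^sup>2 - 2 * Re (z i * cnj c))"
    by (intro sum.cong refl) (simp add: cmod_power2, simp add: power2_eq_square algebra_simps)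
  also have "\<dots> = (\<Sum>i<n. (cmod (z i))\<^sup>2) + real n * (cmod c)\<^sup>2 - 2 * Re ((\<Sum>i<n. z i) * cnj c)"
    by (simp add: sum.distrib sum_subtractf sum_distrib_left sum_distrib_right)
  also have "Re ((\<Sum>i<n. z i) * cnj c) = real n * (cmod c)\<^sup>2"
    unfolding sum_z by (simp add: cmod_power2, simp add: power2_eq_square algebra_simps)
  also have "real n * (cmod c)\<^sup>2 = (cmod (\<Sum>i<n. z i))\<^sup>2 / real n"
    unfolding sum_z using n by (simp add: norm_mult power2_eq_square)
  finally show ?thesis by simp
qed

text \<open>
So \<open>mat_delta\<close> is the distance to the scalar matrices: subtracting the mean of the diagonal
removes exactly the trace term from the squared Frobenius norm.
\<close>

lemma mat_delta_eq_frob_norm: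
  assumes Y: "Y \<in> carrier_mat n n" and n: "n \<ge> 1"
  shows "mat_delta Y = frob_norm (Y - (mat_trace Y / of_nat n) \<cdot>\<^sub>m 1\<^sub>m n)"
proof -
  define c where "c = mat_trace Y / of_nat n"
  have tr: "mat_trace Y = (\<Sum>i<n. Y $$ (i, i))" using Y by (simp add: mat_trace_def)
  have "(frob_norm (Y - c \<cdot>\<^sub>m 1\<^sub>m n))\<^sup>2 = (\<Sum>i<n. \<Sum>j<n. (cmod (Y $$ (i, j) - (if i = j then c else 0)))\<^sup>2)"
    using Y by (subst frob_norm_sq[of _ n n]) (auto intro!: sum.cong)
  also have "\<dots> = (\<Sum>i<n. \<Sum>j<n. (cmod (Y $$ (i, j)))\<^sup>2
      + (if i = j then (cmod (Y $$ (i, i) - c))\<^sup>2 - (cmod (Y $$ (i, i)))\<^sup>2 else 0))"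
    by (intro sum.cong refl) auto
  also have "\<dots> = (frob_norm Y)\<^sup>2 + ((\<Sum>i<n. (cmod (Y $$ (i, i) - c))\<^sup>2) - (\<Sum>i<n. (cmod (Y $$ (i, i)))\<^sup>2))"
    unfolding frob_norm_sq[OF Y] by (simp add: sum.distrib sum_subtractf)
  also have "\<dots> = (frob_norm Y)\<^sup>2 - (cmod (mat_trace Y))\<^sup>2 / real n"
    using sum_cmod_sq_shift[OF n, of "\<lambda>i. Y $$ (i, i)"] by (simp add: c_def tr)
  finally have eq: "(frob_norm Y)\<^sup>2 - (cmod (mat_trace Y))\<^sup>2 / real n = (frob_norm (Y - c \<cdot>\<^sub>m 1\<^sub>m n))\<^sup>2" ..
  show ?thesis unfolding mat_delta_def c_def[symmetric] using Y by (simp add: eq frob_norm_nonneg)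
qed

text \<open>
Sun's theorem with the trace split off. Let \<open>c\<close> be the mean of the diagonal of \<open>F\<close>. Subtracting
the scalar matrix \<open>c\<close> shifts the spectrum of \<open>M\<close> and replaces \<open>\<parallel>F\<parallel>\<close> by \<open>mat_delta F\<close>. The
differences of the matched eigenvalues add up to the trace of \<open>F\<close> for every matching, so undoing
the shift costs \<open>n * |c|\<^sup>2\<close>.
\<close>

lemma spectral_variation_diag:
  fixes M :: "complex mat" and d :: "nat \<Rightarrow> complex"
  assumes n: "n \<ge> 1" and M: "M \<in> carrier_mat n n" "lists_spectrum M l"
  defines "F \<equiv> M - mat_diag n d"
  shows "\<exists>\<sigma>. bij_betw \<sigma> {..<n} {1..n} \<and>
    (\<Sum>i<n. (cmod (l (\<sigma> i) - d i))\<^sup>2) \<le> real n * (mat_delta F)\<^sup>2 + (cmod (mat_trace F))\<^sup>2 / real n"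
proof -
  obtain U where U: "unitary_mat n U" and ut: "upper_triangular (mat_adjoint U * M * U)"
    using unitary_schur[OF M(1)] by auto
  have Uc: "U \<in> carrier_mat n n" "U * mat_adjoint U = 1\<^sub>m n" "mat_adjoint U * U = 1\<^sub>m n"
    using U by (auto simp: unitary_mat_def)
  have Ac: "mat_adjoint U \<in> carrier_mat n n" using Uc by simp
  note mc = mult_carrier_mat[of _ n n _ n]
  define T where "T = mat_adjoint U * M * U"
  have T: "T \<in> carrier_mat n n" "upper_triangular T"
    unfolding T_def using Uc(1) Ac M(1) by (intro mc, simp_all only: ut)
  have F: "F \<in> carrier_mat n n" using M by (simp add: F_def minus_carrier_mat)
  have "similar_mat T M" unfolding similar_mat_def
    by (intro exI, rule similar_mat_witI[of "mat_adjoint U" U n]) (use Uc Ac M T in \<open>auto simp: T_def\<close>)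
  then have "char_poly M = char_poly T" by (simp add: char_poly_similar)
  then obtain \<sigma> where \<sigma>: "bij_betw \<sigma> {..<n} {1..n}" "\<forall>i<n. l (\<sigma> i) = T $$ (i, i)"
    using lists_spectrum_eq_diagonal[OF M T] by auto
  define c where "c = mat_trace F / of_nat n"
  define T' where "T' = T - c \<cdot>\<^sub>m 1\<^sub>m n"
  have T': "T' \<in> carrier_mat n n" "upper_triangular T'"
    using T by (auto simp: T'_def upper_triangular_def)
  obtain \<pi> where \<pi>: "\<pi> permutes {..<n}"
    and bound: "(\<Sum>i<n. (cmod (T' $$ (\<pi> i, \<pi> i) - d i))\<^sup>2)
      \<le> real n * (frob_norm (T' - mat_adjoint U * mat_diag n d * U))\<^sup>2"
    using triangular_diag_distance[OF U T', of d] by auto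
  have "T' - mat_adjoint U * mat_diag n d * U = mat_adjoint U * (F - c \<cdot>\<^sub>m 1\<^sub>m n) * U"
  proof -
    have "mat_adjoint U * (F - c \<cdot>\<^sub>m 1\<^sub>m n) * U = mat_adjoint U * F * U - mat_adjoint U * (c \<cdot>\<^sub>m 1\<^sub>m n) * U"
      using Uc(1) Ac F by (simp add: mult_minus_distrib_mat[of _ n n _ n] minus_mult_distrib_mat[of _ n n _ _ n] mc)
    also have "mat_adjoint U * (c \<cdot>\<^sub>m 1\<^sub>m n) * U = c \<cdot>\<^sub>m 1\<^sub>m n"
    proof -
      have "mat_adjoint U * (c \<cdot>\<^sub>m 1\<^sub>m n) = c \<cdot>\<^sub>m mat_adjoint U"
        using mult_smult_distrib[OF Ac one_carrier_mat, of c] right_mult_one_mat[OF Ac] by simp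
      then show ?thesis using mult_smult_assoc_mat[OF Ac Uc(1), of c] Uc(3) by simp
    qed
    also have "mat_adjoint U * F * U = T - mat_adjoint U * mat_diag n d * U"
      unfolding F_def T_def using Uc(1) Ac M
      by (simp add: mult_minus_distrib_mat[of _ n n _ n] minus_mult_distrib_mat[of _ n n _ _ n] mc)
    finally show ?thesis
      unfolding T'_def using T mc[OF mc[OF Ac mat_diag_dim[of n d]] Uc(1)]
      by (intro eq_matI) auto
  qed
  also have "frob_norm \<dots> = frob_norm (F - c \<cdot>\<^sub>m 1\<^sub>m n)"
    using frob_norm_unitary_left[OF unitary_adjoint[OF U], of "F - c \<cdot>\<^sub>m 1\<^sub>m n" n]
      frob_norm_unitary_right[OF U, of "mat_adjoint U * (F - c \<cdot>\<^sub>m 1\<^sub>m n)" n] Ac F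
    by (simp add: mc minus_carrier_mat)
  finally have bound': "(\<Sum>i<n. (cmod (T' $$ (\<pi> i, \<pi> i) - d i))\<^sup>2) \<le> real n * (mat_delta F)\<^sup>2"
    using bound mat_delta_eq_frob_norm[OF F n] by (simp add: c_def)
  have pi_less: "\<pi> i < n" if "i < n" for i using permutes_in_image[OF \<pi>, of i] that by simp
  define z where "z i = T $$ (\<pi> i, \<pi> i) - d i" for i
  have "(\<Sum>i<n. z i) = mat_trace F"
  proof -
    have "(\<Sum>i<n. T $$ (\<pi> i, \<pi> i)) = (\<Sum>i<n. T $$ (i, i))"
      by (rule sum.permute[OF \<pi>, of "\<lambda>i. T $$ (i, i)", unfolded o_def, symmetric])
    also have "\<dots> = mat_trace T" using T(1) by (simp add: mat_trace_def)
    also have "\<dots> = mat_trace M" unfolding T_def by (rule mat_trace_conj[OF Uc(1) Ac M(1) Uc(2)])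
    finally show ?thesis using M by (simp add: z_def F_def mat_trace_def sum_subtractf mat_diag_def)
  qed
  then have "(\<Sum>i<n. (cmod (z i))\<^sup>2) = (\<Sum>i<n. (cmod (z i - c))\<^sup>2) + (cmod (mat_trace F))\<^sup>2 / real n"
    using sum_cmod_sq_shift[OF n, of z] by (simp add: c_def)
  also have "(\<Sum>i<n. (cmod (z i - c))\<^sup>2) = (\<Sum>i<n. (cmod (T' $$ (\<pi> i, \<pi> i) - d i))\<^sup>2)"
    using T(1) pi_less by (intro sum.cong) (auto simp: z_def T'_def algebra_simps)
  finally have "(\<Sum>i<n. (cmod (z i))\<^sup>2) \<le> real n * (mat_delta F)\<^sup>2 + (cmod (mat_trace F))\<^sup>2 / real n"
    using bound' by simp
  moreover have "(\<Sum>i<n. (cmod (l ((\<sigma> \<circ> \<pi>) i) - d i))\<^sup>2) = (\<Sum>i<n. (cmod (z i))\<^sup>2)"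
    using \<sigma>(2) pi_less by (intro sum.cong) (auto simp: z_def)
  ultimately show ?thesis using bij_betw_trans[OF permutes_imp_bij[OF \<pi>] \<sigma>(1)]
    by (intro exI[of _ "\<sigma> \<circ> \<pi>"] conjI) simp_all
qed


section \<open>Graded scaling of Jordan blocks\<close>

text \<open>
The function \<open>e\<close> gives the position of an index inside its Jordan block, and \<open>S\<close> collects the
positions of the ones. Each block of size \<open>k\<close> contributes \<open>k - 1\<close> of them. What matters for
the scaling below is that \<open>e\<close> grows by one along every element of \<open>S\<close>.
\<close>

lemma jordan_matrix_superdiagonal:
  fixes Js :: "(nat \<times> complex) list"
  assumes "\<forall>J \<in> set Js. fst J \<ge> 1"
  defines "J \<equiv> jordan_matrix Js" and "n \<equiv> sum_list (map fst Js)"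
  shows "\<exists>e S. (\<forall>i<n. \<exists>k\<in>fst ` set Js. e i < k) \<and> S \<subseteq> {..<n} \<times> {..<n} \<and> card S + length Js = n
     \<and> (\<forall>i j. (i, j) \<in> S \<longrightarrow> i \<noteq> j \<and> e j = Suc (e i))
     \<and> (\<forall>i<n. \<forall>j<n. i \<noteq> j \<longrightarrow> J $$ (i, j) = (if (i, j) \<in> S then 1 else 0))"
  using assms(1) unfolding J_def n_def
proof (induction Js)
  case Nil
  then show ?case by auto
next
  case (Cons ka Js)
  obtain k a where ka: "ka = (k, a)" by force
  define n where "n = sum_list (map fst Js)"
  have k: "k \<ge> 1" using Cons.prems ka by simp
  obtain e S where e: "\<forall>i<n. \<exists>k\<in>fst ` set Js. e i < k" and S: "S \<subseteq> {..<n} \<times> {..<n}" "card S + length Js = n"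
    "\<forall>i j. (i, j) \<in> S \<longrightarrow> i \<noteq> j \<and> e j = Suc (e i)"
    and J: "\<forall>i<n. \<forall>j<n. i \<noteq> j \<longrightarrow> jordan_matrix Js $$ (i, j) = (if (i, j) \<in> S then 1 else 0)"
    using Cons unfolding n_def by (auto simp del: jordan_matrix_dim)
  define e' where "e' i = (if i < k then i else e (i - k))" for i
  define S1 where "S1 = (\<lambda>i. (i, Suc i)) ` {..<k - 1}"
  define S2 where "S2 = (\<lambda>(i, j). (i + k, j + k)) ` S"
  have S1: "(i, j) \<in> S1 \<longleftrightarrow> j = Suc i \<and> j < k" for i j by (auto simp: S1_def)
  have S2: "(i, j) \<in> S2 \<longleftrightarrow> i \<ge> k \<and> j \<ge> k \<and> (i - k, j - k) \<in> S" for i j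
    by (auto simp: S2_def image_iff intro!: bexI[of _ "(i - k, j - k)"])
  have "finite S" using S(1) by (rule finite_subset) simp
  have "card (S1 \<union> S2) = card S1 + card S2"
    by (rule card_Un_disjoint) (use \<open>finite S\<close> in \<open>auto simp: S1_def S2_def\<close>)
  also have "card S1 = k - 1" unfolding S1_def by (subst card_image) (auto intro: inj_onI)
  also have "card S2 = card S" unfolding S2_def by (rule card_image) (auto intro: inj_onI)
  finally have card: "card (S1 \<union> S2) + length (ka # Js) = k + n" using S(2) k by simp
  have dims: "sum_list (map fst (ka # Js)) = k + n" by (simp add: ka n_def)
  show ?case unfolding dims
  proof (intro exI conjI allI impI)
    show "\<exists>l\<in>fst ` set (ka # Js). e' i < l" if "i < k + n" for i
      using that e[rule_format, of "i - k"] by (cases "i < k") (auto simp: e'_def ka)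
    show "S1 \<union> S2 \<subseteq> {..<k + n} \<times> {..<k + n}" using S(1) by (auto simp: S1 S2_def)
    show "card (S1 \<union> S2) + length (ka # Js) = k + n" by (rule card)
    show "i \<noteq> j" "e' j = Suc (e' i)" if "(i, j) \<in> S1 \<union> S2" for i j
      using that S(3) by (auto simp: S1 S2 e'_def)
    show "jordan_matrix (ka # Js) $$ (i, j) = (if (i, j) \<in> S1 \<union> S2 then 1 else 0)"
      if "i < k + n" "j < k + n" "i \<noteq> j" for i j
      using that J[rule_format, of "i - k" "j - k"] S(1)
      by (auto simp: ka jordan_matrix_Cons n_def[symmetric] S1 S2)
  qed
qed

lemma sum_le_sqrt_card_mult:
  fixes f :: "'a \<Rightarrow> real"
  shows "(\<Sum>x\<in>A. f x) \<le> sqrt (real (card A)) * sqrt (\<Sum>x\<in>A. (f x)\<^sup>2)"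
proof -
  have "(\<Sum>x\<in>A. 1 * f x)\<^sup>2 \<le> (\<Sum>x\<in>A. 1\<^sup>2) * (\<Sum>x\<in>A. (f x)\<^sup>2)"
    by (rule Cauchy_Schwarz_ineq_sum)
  then show ?thesis by (simp add: real_le_rsqrt flip: real_sqrt_mult)
qed

text \<open>
The exponents \<open>e j - e i\<close> are at least \<open>-(m - 1)\<close>, so the scaling enlarges an entry of \<open>g\<close> at
most by \<open>s ^ (1 - m)\<close>. On \<open>S\<close> the exponent is 1, the scaled entry is \<open>s * g i j\<close>, and the
cross term with \<open>s\<close> is only \<open>2 * s\<^sup>2 * |g i j|\<close>; by Cauchy--Schwarz these add up to at most
\<open>2 * s\<^sup>2 * sqrt (card S) * \<delta>\<close>.
\<close>

lemma graded_scaling_bound: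
  fixes g :: "nat \<Rightarrow> nat \<Rightarrow> complex" and e :: "nat \<Rightarrow> nat" and s \<delta> :: real
  assumes s: "0 < s" "s \<le> 1"
    and e: "\<And>i. i < n \<Longrightarrow> e i < m"
    and S: "S \<subseteq> {..<n} \<times> {..<n}" "\<And>i j. (i, j) \<in> S \<Longrightarrow> e j = Suc (e i)"
    and \<delta>: "\<delta> \<ge> 0" "\<delta>\<^sup>2 = (\<Sum>i<n. \<Sum>j<n. (cmod (g i j))\<^sup>2)"
  shows "(\<Sum>i<n. \<Sum>j<n. (cmod ((if (i, j) \<in> S then of_real s else 0) + of_real (s ^ e j / s ^ e i) * g i j))\<^sup>2)
    \<le> s\<^sup>2 * (real (card S) + 2 * sqrt (real (card S)) * \<delta>) + \<delta>\<^sup>2 / (s\<^sup>2) ^ (m - 1)"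
proof -
  have finS: "finite S" using S(1) by (rule finite_subset) simp
  have "(cmod ((if (i, j) \<in> S then of_real s else 0) + of_real (s ^ e j / s ^ e i) * g i j))\<^sup>2
     \<le> (if (i, j) \<in> S then s\<^sup>2 * (1 + 2 * cmod (g i j)) else 0) + (cmod (g i j))\<^sup>2 / (s\<^sup>2) ^ (m - 1)"
    if ij: "i < n" "j < n" for i j
  proof -
    let ?r = "s ^ e j / s ^ e i"
    have "s ^ (m - 1) \<le> s ^ e i" using s e[OF ij(1)] by (intro power_decreasing) auto
    then have "?r \<le> 1 / s ^ (m - 1)" using s by (intro frac_le) (auto simp: power_le_one)
    then have "?r\<^sup>2 \<le> (1 / s ^ (m - 1))\<^sup>2" using s by (intro power_mono) auto
    then have "?r\<^sup>2 * (cmod (g i j))\<^sup>2 \<le> (1 / s ^ (m - 1))\<^sup>2 * (cmod (g i j))\<^sup>2" by (intro mult_right_mono) auto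
    then have r: "?r\<^sup>2 * (cmod (g i j))\<^sup>2 \<le> (cmod (g i j))\<^sup>2 / (s\<^sup>2) ^ (m - 1)"
      by (simp add: power_divide flip: power_mult) (simp add: mult.commute)
    show ?thesis
    proof (cases "(i, j) \<in> S")
      case True
      then have rs: "?r = s" using S(2) s by simp
      have "cmod (of_real s + of_real ?r * g i j) \<le> s + s * cmod (g i j)"
        unfolding rs using norm_triangle_ineq[of "of_real s" "of_real s * g i j"] s by (simp add: norm_mult)
      then have "(cmod (of_real s + of_real ?r * g i j))\<^sup>2 \<le> (s + s * cmod (g i j))\<^sup>2" by (intro power_mono) auto
      also have "\<dots> = s\<^sup>2 * (1 + 2 * cmod (g i j)) + ?r\<^sup>2 * (cmod (g i j))\<^sup>2"
        unfolding rs by (simp add: power2_eq_square algebra_simps)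
      finally show ?thesis using True r by simp
    next
      case False
      then have "(cmod ((if (i, j) \<in> S then of_real s else 0) + of_real ?r * g i j))\<^sup>2 = ?r\<^sup>2 * (cmod (g i j))\<^sup>2"
        by (simp only: norm_mult norm_of_real power_mult_distrib power2_abs if_False add_0_left)
      then show ?thesis using r False by simp
    qed
  qed
  then have "(\<Sum>i<n. \<Sum>j<n. (cmod ((if (i, j) \<in> S then of_real s else 0) + of_real (s ^ e j / s ^ e i) * g i j))\<^sup>2)
     \<le> (\<Sum>i<n. \<Sum>j<n. (if (i, j) \<in> S then s\<^sup>2 * (1 + 2 * cmod (g i j)) else 0) + (cmod (g i j))\<^sup>2 / (s\<^sup>2) ^ (m - 1))"
    by (intro sum_mono) auto
  also have "\<dots> = s\<^sup>2 * (real (card S) + 2 * (\<Sum>(i, j)\<in>S. cmod (g i j))) + \<delta>\<^sup>2 / (s\<^sup>2) ^ (m - 1)"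
  proof -
    have "(\<Sum>i<n. \<Sum>j<n. if (i, j) \<in> S then s\<^sup>2 * (1 + 2 * cmod (g i j)) else 0)
        = (\<Sum>(i, j)\<in>{..<n} \<times> {..<n}. if (i, j) \<in> S then s\<^sup>2 * (1 + 2 * cmod (g i j)) else 0)"
      by (simp add: sum.cartesian_product)
    also have "\<dots> = (\<Sum>(i, j)\<in>S. s\<^sup>2 * (1 + 2 * cmod (g i j)))"
      by (rule sum.mono_neutral_cong_right) (use S(1) in auto)
    also have "\<dots> = s\<^sup>2 * (real (card S) + 2 * (\<Sum>(i, j)\<in>S. cmod (g i j)))"
      by (simp add: case_prod_unfold sum.distrib flip: sum_distrib_left)
    finally show ?thesis by (simp add: sum.distrib \<delta>(2) flip: sum_divide_distrib)
  qed
  also have "(\<Sum>(i, j)\<in>S. cmod (g i j)) \<le> sqrt (real (card S)) * \<delta>"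
  proof -
    have "(\<Sum>(i, j)\<in>S. cmod (g i j)) \<le> sqrt (real (card S)) * sqrt (\<Sum>x\<in>S. (case x of (i, j) \<Rightarrow> cmod (g i j))\<^sup>2)"
      by (rule sum_le_sqrt_card_mult)
    moreover have "(\<Sum>x\<in>S. (case x of (i, j) \<Rightarrow> cmod (g i j))\<^sup>2) \<le> \<delta>\<^sup>2"
      unfolding \<delta>(2) sum.cartesian_product case_prod_unfold using S(1) by (intro sum_mono2) auto
    then have "sqrt (\<Sum>x\<in>S. (case x of (i, j) \<Rightarrow> cmod (g i j))\<^sup>2) \<le> \<delta>" using \<delta>(1) by (rule real_le_lsqrt[rotated 1])
    ultimately show ?thesis by (meson mult_left_mono order_trans real_sqrt_ge_zero of_nat_0_le_iff)
  qed
  finally show ?thesis using s by (simp add: mult_left_mono mult.assoc)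
qed

text \<open>
The function \<open>x * a + \<delta>\<^sup>2 / x ^ (m - 1)\<close> has its minimum at \<open>x ^ m = (m - 1) * \<delta>\<^sup>2 / a\<close>, which
lies below 1 exactly under the hypothesis \<open>small\<close>. For \<open>\<delta> = 0\<close> the infimum is approached as
\<open>x\<close> tends to 0.
\<close>

lemma optimal_scaling_bound:
  fixes w t a \<delta> N :: real and m :: nat
  assumes w: "\<And>x. 0 < x \<Longrightarrow> x \<le> 1 \<Longrightarrow> w \<le> N * (x * a + \<delta>\<^sup>2 / x ^ (m - 1)) + t"
    and m: "m \<ge> 1" and N: "N > 0" and a: "a \<ge> 0" and \<delta>: "\<delta> \<ge> 0"
    and small: "a > (real m - 1) * \<delta>\<^sup>2"
    and m1: "m = 1 \<Longrightarrow> a = 0"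
  shows "w \<le> real m * N * (a / (real m - 1)) powr (1 - 1 / real m) * \<delta> powr (2 / real m) + t"
proof (cases "\<delta> = 0")
  case True
  have "w \<le> t + \<epsilon>" if "\<epsilon> > 0" for \<epsilon>
  proof -
    define x where "x = min 1 (\<epsilon> / (N * (a + 1)))"
    have pos: "N * (a + 1) > 0" using N a by simp
    then have x: "0 < x" "x \<le> 1" using that by (auto simp: x_def)
    have "N * (x * a) \<le> x * (N * (a + 1))" using N x by (simp add: algebra_simps)
    also have "\<dots> \<le> \<epsilon> / (N * (a + 1)) * (N * (a + 1))"
      using pos by (intro mult_right_mono) (auto simp: x_def)
    also have "\<dots> = \<epsilon>" by (rule nonzero_eq_divide_eq[THEN iffD1, OF _ refl]) (use pos in auto)
    finally show ?thesis using w[OF x] True by simp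
  qed
  then have "w \<le> t" by (rule field_le_epsilon)
  then show ?thesis using True by simp
next
  case False
  with \<delta> have \<delta>: "\<delta> > 0" by simp
  have "m \<noteq> 1"
  proof
    assume "m = 1"
    with m1 small show False by simp
  qed
  with m have m2: "m \<ge> 2" by simp
  \<comment> \<open>The minimiser is \<open>x = (\<delta>\<^sup>2 / b) powr (1 / m)\<close> with \<open>b = a / (m - 1)\<close>; there the second summand
    is \<open>m - 1\<close> times smaller than the first one.\<close>
  define M where "M = real m - 1"
  have M: "M > 0" "real m = M + 1" using m2 by (auto simp: M_def)
  have "0 \<le> M * \<delta>\<^sup>2" using M by simp
  then have a: "a > 0" using small by (simp add: M_def)
  define b where "b = a / M"
  have b: "b > 0" using a M by (simp add: b_def)
  have ab: "a = M * b" using M by (simp add: b_def)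
  have "\<delta>\<^sup>2 < b" using small M by (simp add: b_def pos_less_divide_eq mult.commute flip: M_def)
  then have less: "\<delta>\<^sup>2 / b < 1" using b by simp
  define x where "x = (\<delta>\<^sup>2 / b) powr (1 / real m)"
  have x0: "0 < x" using b \<delta> by (simp add: x_def)
  have x1: "x \<le> 1" unfolding x_def using less b by (intro powr_le1) auto
  have xm: "b * x ^ m = \<delta>\<^sup>2"
  proof -
    have "x ^ m = x powr real m" using powr_realpow[OF x0] by simp
    also have "\<dots> = \<delta>\<^sup>2 / b" unfolding x_def powr_powr using b \<delta> m by simp
    finally show ?thesis using b by simp
  qed
  have "\<delta>\<^sup>2 / x ^ (m - 1) = b * x"
  proof -
    have "x ^ m = x * x ^ (m - 1)" using m by (cases m) auto
    then have "\<delta>\<^sup>2 = (b * x) * x ^ (m - 1)" using xm by (simp add: mult.assoc)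
    then show ?thesis using x0 by simp
  qed
  then have "x * a + \<delta>\<^sup>2 / x ^ (m - 1) = real m * (b * x)"
    unfolding ab M(2) by (simp add: algebra_simps)
  moreover have "b * x = b powr (1 - 1 / real m) * \<delta> powr (2 / real m)"
  proof -
    have "x = (\<delta>\<^sup>2) powr (1 / real m) / b powr (1 / real m)" unfolding x_def using b by (simp add: powr_divide)
    also have "(\<delta>\<^sup>2) powr (1 / real m) = \<delta> powr (2 / real m)"
      using \<delta> by (simp add: powr_powr flip: powr_numeral)
    finally show ?thesis using b by (simp add: powr_diff)
  qed
  ultimately have "w \<le> N * (real m * (b powr (1 - 1 / real m) * \<delta> powr (2 / real m))) + t"
    using w[OF x0 x1] by simp
  then show ?thesis by (simp only: b_def M_def mult_ac)
qed

text \<open>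
Conjugation by \<open>Q\<close> and by the diagonal matrix of the \<open>s ^ e i\<close>, with \<open>e i\<close> the position
of \<open>i\<close> inside its Jordan block, shows that \<open>A + E\<close> is similar to a
perturbation of a diagonal matrix by some \<open>F\<close> which consists of the Jordan ones shrunk to \<open>s\<close> and of
a scaled copy of \<open>EQ\<close>. Diagonal conjugation commutes with subtracting a scalar matrix and keeps the
trace, so \<open>mat_delta F\<close> is controlled by \<open>mat_delta EQ\<close>.
\<close>

lemma scaled_jordan_spectral_variation:
  fixes A E Q Qinv EQ :: "complex mat" and Js :: "(nat \<times> complex) list" and s :: real
  assumes n: "n \<ge> 1"
    and E: "E \<in> carrier_mat n n"
    and Q: "Q \<in> carrier_mat n n" "Qinv \<in> carrier_mat n n" "Q * Qinv = 1\<^sub>m n" "Qinv * Q = 1\<^sub>m n"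
    and sizes: "\<forall>J \<in> set Js. fst J \<ge> 1" "sum_list (map fst Js) = n"
    and A: "A = Q * jordan_matrix Js * Qinv"
    and l: "lists_spectrum A l"
    and l': "lists_spectrum (A + E) l'"
    and EQ: "EQ = Qinv * E * Q"
    and s: "0 < s" "s \<le> 1"
  defines "p \<equiv> length Js" and "m \<equiv> Max (fst ` set Js)" and "\<delta> \<equiv> mat_delta EQ"
  shows "\<exists>\<pi>. \<pi> permutes {1..n} \<and> (\<Sum>i=1..n. (cmod (l' (\<pi> i) - l i))\<^sup>2)
     \<le> real n * (s\<^sup>2 * (real n - real p + 2 * sqrt (real n - real p) * \<delta>) + \<delta>\<^sup>2 / (s\<^sup>2) ^ (m - 1))
       + (cmod (mat_trace E))\<^sup>2 / real n"
proof -
  note mc = mult_carrier_mat[of _ n n _ n] and assoc = assoc_mult_mat[of _ n n _ n _ n]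
  define J where "J = jordan_matrix Js"
  have J: "J \<in> carrier_mat n n" unfolding J_def using jordan_matrix_carrier[of Js] sizes(2) by simp
  have Ac: "A \<in> carrier_mat n n" unfolding A J_def[symmetric] using J Q by (auto intro!: mc)
  have EQc: "EQ \<in> carrier_mat n n" unfolding EQ using E Q by (auto intro!: mc)
  obtain e S where e: "\<forall>i<n. \<exists>k\<in>fst ` set Js. e i < k"
    and S: "S \<subseteq> {..<n} \<times> {..<n}" "card S + length Js = n" "\<forall>i j. (i, j) \<in> S \<longrightarrow> i \<noteq> j \<and> e j = Suc (e i)"
    and J_off: "\<forall>i<n. \<forall>j<n. i \<noteq> j \<longrightarrow> J $$ (i, j) = (if (i, j) \<in> S then 1 else 0)"
    using jordan_matrix_superdiagonal[OF sizes(1)] unfolding sizes(2) J_def by blast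
  have em: "e i < m" if "i < n" for i
  proof -
    have "\<exists>k\<in>fst ` set Js. e i < k" using that by (rule e[rule_format])
    then obtain k where k: "k \<in> fst ` set Js" "e i < k" by (rule bexE)
    have "k \<le> m" unfolding m_def using k(1) by (intro Max_ge) auto
    then show ?thesis using k(2) by simp
  qed
  have cardS: "real (card S) = real n - real p" using S(2) by (simp add: p_def flip: of_nat_add)
  define d where "d i = J $$ (i, i)" for i
  have Jut: "upper_triangular J"
    using J jordan_matrix_upper_triangular[of _ Js] sizes(2) by (auto simp: J_def)
  define D where "D = mat_diag n (\<lambda>i. of_real (s ^ e i) :: complex)"
  define Di where "Di = mat_diag n (\<lambda>i. of_real (1 / s ^ e i) :: complex)"
  have D: "D \<in> carrier_mat n n" "Di \<in> carrier_mat n n" by (auto simp: D_def Di_def)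
  have DDi: "D * Di = 1\<^sub>m n" "Di * D = 1\<^sub>m n"
    using s by (simp_all add: D_def Di_def)
  define M where "M = Di * (J + EQ) * D"
  have M: "M \<in> carrier_mat n n" unfolding M_def using D J EQc by (auto intro!: mc)
  have M_entry: "M $$ (i, j) = of_real (s ^ e j / s ^ e i) * (J $$ (i, j) + EQ $$ (i, j))" if "i < n" "j < n" for i j
  proof -
    have "Di * (J + EQ) \<in> carrier_mat n n" using D J EQc by (intro mc) auto
    then have "M = mat n n (\<lambda>(i, j). (Di * (J + EQ)) $$ (i, j) * of_real (s ^ e j))"
      unfolding M_def D_def by (rule mat_diag_mult_right)
    also have "Di * (J + EQ) = mat n n (\<lambda>(i, j). of_real (1 / s ^ e i) * (J + EQ) $$ (i, j))"
      unfolding Di_def by (rule mat_diag_mult_left) (use J EQc in auto)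
    finally show ?thesis using that J EQc by simp
  qed
  have Qs: "Qinv * (A + E) * Q = J + EQ"
  proof -
    have "Qinv * A * Q = (Qinv * Q) * J * (Qinv * Q)"
      unfolding A J_def[symmetric] using Q(1,2) J by (simp add: assoc mc)
    then have "Qinv * A * Q = J" using Q(4) J by simp
    moreover have "Qinv * (A + E) * Q = Qinv * A * Q + Qinv * E * Q"
      using Q(1,2) Ac E by (simp add: mult_add_distrib_mat[of _ n n _ n] add_mult_distrib_mat[of _ n n _ _ n] mc)
    ultimately show ?thesis by (simp add: EQ)
  qed
  have sim: "similar_mat M (A + E)"
  proof -
    have "similar_mat (J + EQ) (A + E)" unfolding similar_mat_def
      by (intro exI, rule similar_mat_witI[of Qinv Q n]) (use Q Qs J EQc Ac E in auto)
    moreover have "similar_mat M (J + EQ)" unfolding similar_mat_def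
      by (intro exI, rule similar_mat_witI[of Di D n]) (use DDi D M_def J EQc M in auto)
    ultimately show ?thesis using similar_mat_trans by blast
  qed
  have lM: "lists_spectrum M l'"
    using l' M Ac E by (simp add: lists_spectrum_def char_poly_similar[OF sim])
  define F where "F = M - mat_diag n d"
  have F: "F \<in> carrier_mat n n" using M by (simp add: F_def minus_carrier_mat)
  obtain \<sigma> where \<sigma>: "bij_betw \<sigma> {..<n} {1..n}"
    and bound: "(\<Sum>i<n. (cmod (l' (\<sigma> i) - d i))\<^sup>2) \<le> real n * (mat_delta F)\<^sup>2 + (cmod (mat_trace F))\<^sup>2 / real n"
    using spectral_variation_diag[OF n M lM, of d] unfolding F_def by auto
  have F_entry: "F $$ (i, j) = (if (i, j) \<in> S then of_real s else 0) + of_real (s ^ e j / s ^ e i) * EQ $$ (i, j)"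
    if ij: "i < n" "j < n" for i j
  proof (cases "i = j")
    case True
    then show ?thesis using ij S(3) s M by (auto simp: F_def M_entry d_def mat_diag_def)
  next
    case False
    then show ?thesis using ij S(3) s M J_off by (auto simp: F_def M_entry mat_diag_def algebra_simps)
  qed
  have nS: "(i, i) \<notin> S" for i using S(3) by blast
  have trF: "mat_trace F = mat_trace EQ"
    unfolding mat_trace_def using F EQc s by (intro sum.cong) (auto simp: F_entry nS)
  define c where "c = mat_trace EQ / of_nat n"
  define g where "g i j = EQ $$ (i, j) - (if i = j then c else 0)" for i j
  have \<delta>: "\<delta>\<^sup>2 = (\<Sum>i<n. \<Sum>j<n. (cmod (g i j))\<^sup>2)"
    unfolding \<delta>_def mat_delta_eq_frob_norm[OF EQc n] c_def[symmetric] using EQc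
    by (subst frob_norm_sq[of _ n n]) (auto simp: g_def intro!: sum.cong minus_carrier_mat)
  have \<delta>0: "\<delta> \<ge> 0" unfolding \<delta>_def mat_delta_eq_frob_norm[OF EQc n] by (rule frob_norm_nonneg)
  have "(mat_delta F)\<^sup>2 = (\<Sum>i<n. \<Sum>j<n. (cmod ((if (i, j) \<in> S then of_real s else 0) + of_real (s ^ e j / s ^ e i) * g i j))\<^sup>2)"
    unfolding mat_delta_eq_frob_norm[OF F n] trF c_def[symmetric] using F s
    by (subst frob_norm_sq[of _ n n]) (auto simp: g_def F_entry algebra_simps intro!: sum.cong minus_carrier_mat)
  also have "\<dots> \<le> s\<^sup>2 * (real (card S) + 2 * sqrt (real (card S)) * \<delta>) + \<delta>\<^sup>2 / (s\<^sup>2) ^ (m - 1)"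
    by (rule graded_scaling_bound[OF s em S(1) _ \<delta>0 \<delta>]) (use S(3) in blast)+
  finally have delta_F: "(mat_delta F)\<^sup>2 \<le> s\<^sup>2 * (real n - real p + 2 * sqrt (real n - real p) * \<delta>) + \<delta>\<^sup>2 / (s\<^sup>2) ^ (m - 1)"
    by (simp only: cardS)
  have trE: "mat_trace EQ = mat_trace E" unfolding EQ by (rule mat_trace_conj[OF Q(1,2) E Q(3)])
  have "similar_mat A J" unfolding similar_mat_def
    by (intro exI, rule similar_mat_witI[of Q Qinv n]) (use Q A Ac J in \<open>auto simp: J_def\<close>)
  then obtain \<tau> where \<tau>: "bij_betw \<tau> {..<n} {1..n}" "\<forall>i<n. l (\<tau> i) = d i"
    using lists_spectrum_eq_diagonal[OF Ac l J Jut] char_poly_similar unfolding d_def by blast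
  define \<tau>' where "\<tau>' = the_inv_into {..<n} \<tau>"
  have \<tau>': "bij_betw \<tau>' {1..n} {..<n}" "\<And>k. k \<in> {1..n} \<Longrightarrow> \<tau> (\<tau>' k) = k"
    unfolding \<tau>'_def using \<tau>(1) by (auto intro: bij_betw_the_inv_into f_the_inv_into_f_bij_betw)
  define \<pi> where "\<pi> k = (if k \<in> {1..n} then \<sigma> (\<tau>' k) else k)" for k
  have "bij_betw \<pi> {1..n} {1..n}"
    using bij_betw_trans[OF \<tau>'(1) \<sigma>] by (subst bij_betw_cong[of _ _ "\<sigma> \<circ> \<tau>'"]) (auto simp: \<pi>_def)
  then have perm: "\<pi> permutes {1..n}" by (rule bij_imp_permutes) (auto simp: \<pi>_def)
  have "(\<Sum>k=1..n. (cmod (l' (\<pi> k) - l k))\<^sup>2) = (\<Sum>k=1..n. (cmod (l' (\<sigma> (\<tau>' k)) - d (\<tau>' k)))\<^sup>2)"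
  proof (intro sum.cong refl)
    fix k assume k: "k \<in> {1..n}"
    have "\<tau>' k < n" using bij_betwE[OF \<tau>'(1)] k by auto
    then show "(cmod (l' (\<pi> k) - l k))\<^sup>2 = (cmod (l' (\<sigma> (\<tau>' k)) - d (\<tau>' k)))\<^sup>2"
      using \<tau>(2) \<tau>'(2)[OF k] k by (auto simp: \<pi>_def)
  qed
  also have "\<dots> = (\<Sum>i<n. (cmod (l' (\<sigma> i) - d i))\<^sup>2)"
    by (rule sum.reindex_bij_betw[OF \<tau>'(1)])
  also note bound
  also have "real n * (mat_delta F)\<^sup>2 \<le> real n * (s\<^sup>2 * (real n - real p + 2 * sqrt (real n - real p) * \<delta>) + \<delta>\<^sup>2 / (s\<^sup>2) ^ (m - 1))"
    using delta_F by (intro mult_left_mono) auto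
  finally show ?thesis using perm by (auto simp: trF trE)
qed

section \<open>Spectral variation of an arbitrary matrix\<close>

theorem theorem3p4:
  fixes n p m :: nat
    and A A' E Q Qinv EQ :: "complex mat"
    and Js :: "(nat \<times> complex) list"
    and l l' :: "nat \<Rightarrow> complex"
  assumes n: "n \<ge> 1"
    and A: "A \<in> carrier_mat n n"
    and E: "E \<in> carrier_mat n n"
    and Q: "Q \<in> carrier_mat n n"
    and Qinv: "Qinv \<in> carrier_mat n n" "inverts_mat Q Qinv" "inverts_mat Qinv Q"
    and sizes: "\<forall>J \<in> set Js. fst J \<ge> 1" "sum_list (map fst Js) = n"
    and fact: "A = Q * jordan_matrix Js * Qinv"
    and A': "A' = A + E"
    and l: "lists_spectrum A l"
    and l': "lists_spectrum A' l'"
    and p: "p = length Js"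
    and m: "m = Max (fst ` set Js)"
    and EQ: "EQ = Qinv * E * Q"
  shows "\<exists>\<pi>. \<pi> permutes {1..n} \<and>
    sqrt (\<Sum>i=1..n. (cmod (l' (\<pi> i) - l i))\<^sup>2) \<le>
      (if real n - real p + 2 * sqrt (real n - real p) * mat_delta EQ
            > (real m - 1) * (mat_delta EQ)\<^sup>2
       then sqrt (real m * real n
              * ((real n - real p + 2 * sqrt (real n - real p) * mat_delta EQ) / (real m - 1))
                  powr (1 - 1 / real m)
              * mat_delta EQ powr (2 / real m)
              + (cmod (mat_trace E))\<^sup>2 / real n)
       else sqrt (real n * (sqrt (real n - real p) + mat_delta EQ)\<^sup>2
              + (cmod (mat_trace E))\<^sup>2 / real n))"
proof -
  define \<delta> where "\<delta> = mat_delta EQ"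
  define a where "a = real n - real p + 2 * sqrt (real n - real p) * \<delta>"
  define t where "t = (cmod (mat_trace E))\<^sup>2 / real n"
  define cost where "cost \<pi> = (\<Sum>i=1..n. (cmod (l' (\<pi> i) - l i))\<^sup>2)" for \<pi>
  have QQ: "Q * Qinv = 1\<^sub>m n" "Qinv * Q = 1\<^sub>m n"
    using Q Qinv by (auto simp: inverts_mat_def)
  have ex_s: "\<exists>\<pi>. \<pi> permutes {1..n} \<and> cost \<pi> \<le> real n * (s\<^sup>2 * a + \<delta>\<^sup>2 / (s\<^sup>2) ^ (m - 1)) + t"
    if "0 < s" "s \<le> 1" for s :: real
    using scaled_jordan_spectral_variation[OF n E Q Qinv(1) QQ sizes fact l l'[unfolded A'] EQ that]
    unfolding cost_def a_def t_def \<delta>_def m p .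
  have "{\<pi>. \<pi> permutes {1..n}} \<noteq> {}" using permutes_id by blast
  from ex_is_arg_min_if_finite[OF finite_permutations[OF finite_atLeastAtMost] this, of cost]
  obtain \<pi> where \<pi>: "\<pi> permutes {1..n}" and least: "\<And>\<rho>. \<rho> permutes {1..n} \<Longrightarrow> cost \<pi> \<le> cost \<rho>"
    by (auto simp: is_arg_min_linorder)
  have bound: "cost \<pi> \<le> real n * (x * a + \<delta>\<^sup>2 / x ^ (m - 1)) + t" if x: "0 < x" "x \<le> 1" for x
  proof -
    obtain \<rho> where "\<rho> permutes {1..n}" "cost \<rho> \<le> real n * (x * a + \<delta>\<^sup>2 / x ^ (m - 1)) + t"
      using ex_s[of "sqrt x"] x by auto
    with least[of \<rho>] show ?thesis by linarith
  qed
  have "EQ \<in> carrier_mat n n" unfolding EQ using E Q Qinv(1)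
    by (intro mult_carrier_mat[of _ n n _ n])
  then have \<delta>: "\<delta> \<ge> 0" unfolding \<delta>_def by (simp add: mat_delta_eq_frob_norm[OF _ n] frob_norm_nonneg)
  have "length Ks \<le> sum_list (map fst Ks)" if "\<forall>J \<in> set Ks. fst J \<ge> 1" for Ks :: "(nat \<times> complex) list"
    using that by (induction Ks) auto
  from this[OF sizes(1)] have pn: "p \<le> n" using sizes(2) p by simp
  have a: "a \<ge> 0" unfolding a_def using pn \<delta> by simp
  have sizes_le: "\<forall>J \<in> set Js. fst J \<le> m" unfolding m by simp
  have "Js \<noteq> []" using n sizes(2) by auto
  then have "hd Js \<in> set Js" by (rule hd_in_set)
  from bspec[OF sizes(1) this] bspec[OF sizes_le this] have m1: "m \<ge> 1" by (rule order_trans)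
  \<comment> \<open>If all blocks have size one, then the first case of the bound does not occur.\<close>
  have a0: "a = 0" if "m = 1"
  proof -
    have "map fst Js = map (\<lambda>_. 1) Js" using sizes(1) sizes_le that by (intro map_cong refl) force
    from arg_cong[OF this, of sum_list] have "n = p" unfolding sizes(2) by (simp add: p sum_list_triv)
    then show ?thesis by (simp add: a_def)
  qed
  have "sqrt (cost \<pi>) \<le> (if a > (real m - 1) * \<delta>\<^sup>2
       then sqrt (real m * real n * (a / (real m - 1)) powr (1 - 1 / real m) * \<delta> powr (2 / real m) + t)
       else sqrt (real n * (sqrt (real n - real p) + \<delta>)\<^sup>2 + t))"
  proof (cases "a > (real m - 1) * \<delta>\<^sup>2")
    case True
    have "cost \<pi> \<le> real m * real n * (a / (real m - 1)) powr (1 - 1 / real m) * \<delta> powr (2 / real m) + t"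
      by (rule optimal_scaling_bound[OF bound m1 _ a \<delta> True a0]) (use n in auto)
    then show ?thesis using True by simp
  next
    case False
    have "a + \<delta>\<^sup>2 = (sqrt (real n - real p) + \<delta>)\<^sup>2" using pn by (simp add: a_def power2_sum)
    then show ?thesis using False bound[of 1] by simp
  qed
  then show ?thesis using \<pi> unfolding cost_def a_def t_def \<delta>_def by blast
qed

end
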